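(* There exists a planar $3$-tree whose queue number is at least $4$. In particular, there exist planar graphs with queue number at least $4$.
   Context: A planar $3$-tree is a triangulated plane graph $G$ with $n\ge 3$ vertices such that either $n=3$ and $G$ is a $3$-cycle, or $n>3$ and $G$ has a vertex whose deletion yields a planar $3$-tree with $n-1$ vertices. A $k$-queue layout of a graph $G$ consists of a linear order $\prec$ of the vertices of $G$ and a partition of the edges of $G$ into $k$ sets (queues) such that no two independent edges (edges sharing no endvertex) of the same queue are nested. Two edges $(s_1,t_1)$ and $(s_2,t_2)$ with $s_1\prec t_1$, $s_2\prec t_2$ are nested if $s_1\prec s_2\prec t_2\prec t_1$ or $s_2\prec s_1\prec t_1\prec t_2$. The queue number of $G$ is the minimum $k$ such that $G$ admits a $k$-queue layout. *)

theory Defs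
  imports Main "HOL-Library.Multiset"
begin

text \<open>Graphs: a vertex set V and a set E of 2-element vertex sets.
Planar 3-trees (stacked triangulations), generated combinatorially: start with a
triangle (which has two triangular faces, inner and outer) and repeatedly insert a
new vertex into a face {a,b,c}, joining it to a, b, c and splitting the face into
three faces. Faces are kept as a multiset of 3-element vertex sets.\<close>

inductive p3t :: "'a set \<Rightarrow> 'a set set \<Rightarrow> 'a set multiset \<Rightarrow> bool" where
  base: "\<lbrakk>a \<noteq> b; b \<noteq> c; a \<noteq> c\<rbrakk> \<Longrightarrow>
     p3t {a,b,c} {{a,b},{b,c},{a,c}} {#{a,b,c},{a,b,c}#}"
| stack: "\<lbrakk>p3t V E Fs; {a,b,c} \<in># Fs; a \<noteq> b; b \<noteq> c; a \<noteq> c; v \<notin> V\<rbrakk> \<Longrightarrow>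
     p3t (insert v V) (E \<union> {{v,a},{v,b},{v,c}})
         (Fs - {#{a,b,c}#} + {#{a,b,v},{b,c,v},{a,c,v}#})"

definition planar_3_tree :: "'a set \<Rightarrow> 'a set set \<Rightarrow> bool" where
  "planar_3_tree V E \<longleftrightarrow> (\<exists>Fs. p3t V E Fs)"

definition prec :: "'a list \<Rightarrow> 'a \<Rightarrow> 'a \<Rightarrow> bool" where
  "prec vs x y \<longleftrightarrow> (\<exists>i j. i < j \<and> j < length vs \<and> vs ! i = x \<and> vs ! j = y)"

text \<open>A k-queue layout: linear order vs of V, queue assignment q : E -> {0..<k},
no two edges of the same queue nested (nested edges are automatically independent).\<close>
definition queue_layout :: "'a set \<Rightarrow> 'a set set \<Rightarrow> nat \<Rightarrow> 'a list \<Rightarrow> ('a set \<Rightarrow> nat) \<Rightarrow> bool" where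
  "queue_layout V E k vs q \<longleftrightarrow>
     distinct vs \<and> set vs = V \<and> (\<forall>e\<in>E. q e < k) \<and>
     (\<forall>s1 t1 s2 t2. {s1,t1} \<in> E \<and> {s2,t2} \<in> E \<and> q {s1,t1} = q {s2,t2} \<and>
        prec vs s1 s2 \<and> prec vs s2 t2 \<and> prec vs t2 t1 \<longrightarrow> False)"

definition queue_number :: "'a set \<Rightarrow> 'a set set \<Rightarrow> nat" where
  "queue_number V E = (LEAST k. \<exists>vs q. queue_layout V E k vs q)"

end

theory Submission
  imports Defs "HOL-Library.FuncSet"
begin

text \<open>
  Take a face that is stacked very deeply, and suppose its graph has a layout with three queues; then
  no four edges are pairwise nested (a rainbow). Stacking repeatedly next to an edge $AB$ produces a
  path of common neighbours of $A$ and $B$, hence many disjoint adjacent pairs $y, z$ of them, each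
  with deeply stacked faces $Ayz$ and $Byz$. If some pair lies strictly between $A$ and $B$, then $yz$
  is nested in $AB$, and the argument is repeated for $yz$; three repetitions give a rainbow.
  Otherwise, by the pigeonhole principle and up to reversal of the order, many pairs have the same
  queue and the same type: both vertices left of $A$, one left of $A$ and one between $A$ and $B$, or
  one left of $A$ and one right of $B$. Edges of one queue do not nest, so in such a family both the
  left and the right ends increase, and a family with both vertices left of $A$ contains a large
  subfamily of pairwise crossing or of pairwise separated pairs.

  Each of these four configurations is refuted by a game. We choose a face, the opponent reveals the
  position of the vertex stacked into it, and we win once there is a rainbow. Winning strategies were
  found by computer search; they are finite trees that are checked here by evaluation.
\<close>

section \<open>Deeply stacked faces\<close>

text \<open>
  The last argument contains all vertices inside the face. Tracking it keeps vertices stacked into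
  different faces distinct, which the edge set alone does not show.
\<close>

fun deep :: "'a set set \<Rightarrow> nat \<Rightarrow> 'a \<Rightarrow> 'a \<Rightarrow> 'a \<Rightarrow> 'a set \<Rightarrow> bool" where
  "deep E 0 a b c S \<longleftrightarrow> {a, b} \<in> E \<and> {b, c} \<in> E \<and> {a, c} \<in> E"
| "deep E (Suc d) a b c S \<longleftrightarrow> {a, b} \<in> E \<and> {b, c} \<in> E \<and> {a, c} \<in> E \<and>
     (\<exists>v S1 S2 S3. v \<in> S \<and> S1 \<subseteq> S - {v} \<and> S2 \<subseteq> S - {v} \<and> S3 \<subseteq> S - {v} \<and>
        S1 \<inter> S2 = {} \<and> S2 \<inter> S3 = {} \<and> S1 \<inter> S3 = {} \<and>
        deep E d a b v S1 \<and> deep E d b c v S2 \<and> deep E d a c v S3)"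

lemma deep_edges:
  assumes "deep E d a b c S"
  shows "{a, b} \<in> E" "{b, c} \<in> E" "{a, c} \<in> E"
  using assms by (cases d; simp)+

lemma deep_stack:
  assumes "deep E (Suc d) a b c S"
  obtains v S1 S2 S3 where "v \<in> S" "S1 \<subseteq> S - {v}" "S2 \<subseteq> S - {v}" "S3 \<subseteq> S - {v}"
    "S1 \<inter> S2 = {}" "S2 \<inter> S3 = {}" "S1 \<inter> S3 = {}"
    "deep E d a b v S1" "deep E d b c v S2" "deep E d a c v S3"
  using assms by auto

lemma deep_SucI:
  assumes "v \<in> S" "S1 \<subseteq> S - {v}" "S2 \<subseteq> S - {v}" "S3 \<subseteq> S - {v}"
    "S1 \<inter> S2 = {}" "S2 \<inter> S3 = {}" "S1 \<inter> S3 = {}"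
    "deep E d a b v S1" "deep E d b c v S2" "deep E d a c v S3"
    "{a, b} \<in> E" "{b, c} \<in> E" "{a, c} \<in> E"
  shows "deep E (Suc d) a b c S"
  unfolding deep.simps
  by (intro conjI exI[of _ v] exI[of _ S1] exI[of _ S2] exI[of _ S3]) (rule assms)+

text \<open>Exchanging \<open>a\<close> and \<open>b\<close> exchanges the small faces
  \<open>b c v\<close> and \<open>a c v\<close>, hence their interiors \<open>S2\<close> and
  \<open>S3\<close>. Together with \<open>deep_swap23\<close> this makes the order of the three
  corners immaterial.\<close>

lemma deep_swap12: "deep E d a b c S \<Longrightarrow> deep E d b a c S"
proof (induction d arbitrary: a b c S)
  case 0
  then show ?case by (simp add: insert_commute)
next
  case (Suc d)
  obtain v S1 S2 S3 where v: "v \<in> S" "S1 \<subseteq> S - {v}" "S2 \<subseteq> S - {v}" "S3 \<subseteq> S - {v}"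
    "S1 \<inter> S2 = {}" "S2 \<inter> S3 = {}" "S1 \<inter> S3 = {}"
    "deep E d a b v S1" "deep E d b c v S2" "deep E d a c v S3"
    using Suc.prems by (rule deep_stack)
  have "S2 \<inter> S1 = {}" "S3 \<inter> S2 = {}" "S3 \<inter> S1 = {}" using v(5-7) by blast+
  then show ?case
    using Suc.IH[OF v(8)] v(9,10) deep_edges[OF Suc.prems] v(1-7)
    by (intro deep_SucI[of v S S1 S3 S2]) (auto simp: insert_commute simp del: deep.simps)
qed

lemma deep_swap23: "deep E d a b c S \<Longrightarrow> deep E d a c b S"
proof (induction d arbitrary: a b c S)
  case 0
  then show ?case by (simp add: insert_commute)
next
  case (Suc d)
  obtain v S1 S2 S3 where v: "v \<in> S" "S1 \<subseteq> S - {v}" "S2 \<subseteq> S - {v}" "S3 \<subseteq> S - {v}"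
    "S1 \<inter> S2 = {}" "S2 \<inter> S3 = {}" "S1 \<inter> S3 = {}"
    "deep E d a b v S1" "deep E d b c v S2" "deep E d a c v S3"
    using Suc.prems by (rule deep_stack)
  have "S2 \<inter> S1 = {}" "S3 \<inter> S2 = {}" "S3 \<inter> S1 = {}" using v(5-7) by blast+
  then show ?case
    using v(8,10) deep_swap12[OF v(9)] deep_edges[OF Suc.prems] v(1-7)
    by (intro deep_SucI[of v S S3 S2 S1]) (auto simp: insert_commute simp del: deep.simps)
qed

lemma deep_Suc: "deep E (Suc d) a b c S \<Longrightarrow> deep E d a b c S"
proof (induction d arbitrary: a b c S)
  case 0
  then show ?case using deep_edges[OF 0] by simp
next
  case (Suc d)
  obtain v S1 S2 S3 where v: "v \<in> S" "S1 \<subseteq> S - {v}" "S2 \<subseteq> S - {v}" "S3 \<subseteq> S - {v}"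
    "S1 \<inter> S2 = {}" "S2 \<inter> S3 = {}" "S1 \<inter> S3 = {}"
    "deep E (Suc d) a b v S1" "deep E (Suc d) b c v S2" "deep E (Suc d) a c v S3"
    using Suc.prems by (rule deep_stack)
  then show ?case
    using Suc.IH[OF v(8)] Suc.IH[OF v(9)] Suc.IH[OF v(10)] deep_edges[OF Suc.prems] v(1-7)
    by (intro deep_SucI[of v S S1 S2 S3]) (simp_all del: deep.simps)
qed

lemma deep_le: "deep E d' a b c S \<Longrightarrow> d \<le> d' \<Longrightarrow> deep E d a b c S"
  by (induction d') (auto simp: le_Suc_eq dest: deep_Suc simp del: deep.simps(2))

text \<open>Serves to enlarge the edge set (\<open>f = id\<close>), to reverse the order
  (\<open>f = uminus\<close>) and to pass from vertices to positions. Injectivity on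
  \<open>S\<close> keeps the images of the interiors disjoint.\<close>

lemma deep_image:
  assumes "deep E d a b c S" "inj_on f S" "\<And>x y. {x, y} \<in> E \<Longrightarrow> {f x, f y} \<in> E'"
  shows "deep E' d (f a) (f b) (f c) (f ` S)"
  using assms(1,2)
proof (induction d arbitrary: a b c S)
  case 0
  then show ?case using assms(3) by simp
next
  case (Suc d)
  obtain v S1 S2 S3 where v: "v \<in> S" "S1 \<subseteq> S - {v}" "S2 \<subseteq> S - {v}" "S3 \<subseteq> S - {v}"
    "S1 \<inter> S2 = {}" "S2 \<inter> S3 = {}" "S1 \<inter> S3 = {}"
    "deep E d a b v S1" "deep E d b c v S2" "deep E d a c v S3"
    using Suc.prems(1) by (rule deep_stack)
  have sub: "f ` T \<subseteq> f ` S - {f v}" "inj_on f T" if "T \<subseteq> S - {v}" for T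
    using that v(1) Suc.prems(2) by (auto simp: inj_on_def)
  have disj: "f ` T \<inter> f ` T' = {}" if "T \<subseteq> S - {v}" "T' \<subseteq> S - {v}" "T \<inter> T' = {}" for T T'
  proof -
    have "T \<subseteq> S" "T' \<subseteq> S" using that by auto
    then show ?thesis using that(3) inj_on_image_Int[OF Suc.prems(2), of T T'] by simp
  qed
  have "deep E' d (f a) (f b) (f v) (f ` S1)" "deep E' d (f b) (f c) (f v) (f ` S2)"
    "deep E' d (f a) (f c) (f v) (f ` S3)"
    using Suc.IH[OF v(8) sub(2)[OF v(2)]] Suc.IH[OF v(9) sub(2)[OF v(3)]]
      Suc.IH[OF v(10) sub(2)[OF v(4)]] by simp_all
  moreover have "f v \<in> f ` S" "f ` S1 \<subseteq> f ` S - {f v}" "f ` S2 \<subseteq> f ` S - {f v}"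
    "f ` S3 \<subseteq> f ` S - {f v}" using v(1) sub(1)[OF v(2)] sub(1)[OF v(3)] sub(1)[OF v(4)] by simp_all
  moreover have "f ` S1 \<inter> f ` S2 = {}" "f ` S2 \<inter> f ` S3 = {}" "f ` S1 \<inter> f ` S3 = {}"
    using disj[OF v(2,3,5)] disj[OF v(3,4,6)] disj[OF v(2,4,7)] by simp_all
  ultimately show ?case using deep_edges[OF Suc.prems(1)] assms(3)
    by (intro deep_SucI[of "f v" _ "f ` S1" "f ` S2" "f ` S3"]) auto
qed

lemma deep_mono: "deep E d a b c S \<Longrightarrow> E \<subseteq> E' \<Longrightarrow> deep E' d a b c S"
  using deep_image[of E d a b c S id E'] by auto

section \<open>Planar 3-trees with a deeply stacked face\<close>

lemma p3t_finite: "p3t V E Fs \<Longrightarrow> finite V"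
  by (induction rule: p3t.induct) auto

lemma p3t_face_subset: "p3t V E Fs \<Longrightarrow> F \<in># Fs \<Longrightarrow> F \<subseteq> V"
proof (induction arbitrary: F rule: p3t.induct)
  case (stack V E Fs a b c v)
  have "{a, b, c} \<subseteq> V" using stack.IH stack.hyps(2) .
  moreover have "F \<in># Fs \<or> F \<in> {{a, b, v}, {b, c, v}, {a, c, v}}"
    using stack.prems by (auto dest: in_diffD)
  ultimately show ?case using stack.IH by blast
qed auto

lemma p3t_edge_subset: "p3t V E Fs \<Longrightarrow> e \<in> E \<Longrightarrow> e \<subseteq> V"
proof (induction arbitrary: e rule: p3t.induct)
  case (stack V E Fs a b c v)
  have "{a, b, c} \<subseteq> V" using p3t_face_subset stack.hyps(1,2) .
  then show ?case using stack.IH stack.prems by blast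
qed auto

text \<open>The three faces created by the new vertex are deepened one after the other. The multiset
  inclusion records that all other faces survive, so the second and third face are still available
  when their turn comes; \<open>V \<inter> S = {}\<close> makes the three interiors disjoint. Over
  \<open>nat\<close> a fresh vertex always exists.\<close>

lemma p3t_deepen:
  fixes V :: "nat set"
  assumes "p3t V E Fs" "{a, b, c} \<in># Fs" "a \<noteq> b" "b \<noteq> c" "a \<noteq> c"
    "{a, b} \<in> E" "{b, c} \<in> E" "{a, c} \<in> E"
  shows "\<exists>E' Fs' S. p3t (V \<union> S) E' Fs' \<and> E \<subseteq> E' \<and> V \<inter> S = {} \<and>
    Fs - {#{a, b, c}#} \<subseteq># Fs' \<and> deep E' d a b c S"
  using assms
proof (induction d arbitrary: V E Fs a b c)
  case 0
  then have "p3t (V \<union> {}) E Fs \<and> E \<subseteq> E \<and> V \<inter> {} = {} \<and>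
    Fs - {#{a, b, c}#} \<subseteq># Fs \<and> deep E 0 a b c {}" by simp
  then show ?case by blast
next
  case (Suc d)
  obtain v where v: "v \<notin> V" using p3t_finite[OF Suc.prems(1)] ex_new_if_finite infinite_UNIV_nat by blast
  have "{a, b, c} \<subseteq> V" using p3t_face_subset Suc.prems(1,2) .
  with v have ne: "a \<noteq> v" "b \<noteq> v" "c \<noteq> v" by auto
  define R where "R = Fs - {#{a, b, c}#}"
  define E0 where "E0 = E \<union> {{v, a}, {v, b}, {v, c}}"
  have 0: "p3t (insert v V) E0 (R + {#{a, b, v}, {b, c, v}, {a, c, v}#})"
    unfolding E0_def R_def using p3t.stack Suc.prems(1-5) v .
  have E0: "E \<subseteq> E0" "{a, v} \<in> E0" "{b, v} \<in> E0" "{c, v} \<in> E0"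
    unfolding E0_def by (auto simp: insert_commute)
  have "{a, b} \<in> E0" "{b, c} \<in> E0" "{a, c} \<in> E0" using E0(1) Suc.prems by auto
  note E0 = E0 this
  obtain E1 F1 S1 where 1: "p3t (insert v V \<union> S1) E1 F1" "E0 \<subseteq> E1" "insert v V \<inter> S1 = {}"
      "R + {#{a, b, v}, {b, c, v}, {a, c, v}#} - {#{a, b, v}#} \<subseteq># F1" "deep E1 d a b v S1"
    using Suc.IH[OF 0 _ Suc.prems(3) ne(2) ne(1) E0(5) E0(3) E0(2)] by auto
  \<comment> \<open>Only one copy of \<open>{a, b, v}\<close> has been used up, so the two sibling
    faces and the old faces \<open>R\<close> are still present.\<close>
  have F1: "add_mset {b, c, v} (add_mset {a, c, v} R) \<subseteq># F1" using 1(4) by simp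
  have in1: "{b, c, v} \<in># F1" by (rule mset_subset_eqD[OF F1]) simp
  have E1: "{b, c} \<in> E1" "{c, v} \<in> E1" "{b, v} \<in> E1" using E0 1(2) by blast+
  obtain E2 F2 S2 where 2: "p3t (insert v V \<union> S1 \<union> S2) E2 F2" "E1 \<subseteq> E2"
      "(insert v V \<union> S1) \<inter> S2 = {}" "F1 - {#{b, c, v}#} \<subseteq># F2" "deep E2 d b c v S2"
    using Suc.IH[OF 1(1) in1 Suc.prems(4) ne(3) ne(2) E1] by blast
  have F2: "add_mset {a, c, v} R \<subseteq># F2"
    by (rule subset_mset.order_trans[OF conjunct2[OF iffD1[OF insert_subset_eq_iff F1]] 2(4)])
  have in2: "{a, c, v} \<in># F2" by (rule mset_subset_eqD[OF F2]) simp
  have E2: "{a, c} \<in> E2" "{c, v} \<in> E2" "{a, v} \<in> E2" using E0 1(2) 2(2) by blast+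
  obtain E3 F3 S3 where 3: "p3t (insert v V \<union> S1 \<union> S2 \<union> S3) E3 F3" "E2 \<subseteq> E3"
      "(insert v V \<union> S1 \<union> S2) \<inter> S3 = {}" "F2 - {#{a, c, v}#} \<subseteq># F3" "deep E3 d a c v S3"
    using Suc.IH[OF 2(1) in2 Suc.prems(5) ne(3) ne(1) E2] by blast
  have F3: "R \<subseteq># F3"
    by (rule subset_mset.order_trans[OF conjunct2[OF iffD1[OF insert_subset_eq_iff F2]] 3(4)])
  define S where "S = insert v (S1 \<union> S2 \<union> S3)"
  have E3: "E0 \<subseteq> E3" using 1(2) 2(2) 3(2) by simp
  have "{a, b} \<in> E3" "{b, c} \<in> E3" "{a, c} \<in> E3" using E0(5-7) E3 by auto
  moreover have "deep E3 d a b v S1" "deep E3 d b c v S2"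
    using deep_mono[OF 1(5)] deep_mono[OF 2(5)] 2(2) 3(2) by simp_all
  moreover have "v \<in> S" "S1 \<subseteq> S - {v}" "S2 \<subseteq> S - {v}" "S3 \<subseteq> S - {v}"
    "S1 \<inter> S2 = {}" "S2 \<inter> S3 = {}" "S1 \<inter> S3 = {}"
    unfolding S_def using 1(3) 2(3) 3(3) by auto
  ultimately have "deep E3 (Suc d) a b c S" using 3(5) by (intro deep_SucI[of v S S1 S2 S3])
  moreover have "V \<union> S = insert v V \<union> S1 \<union> S2 \<union> S3" unfolding S_def by auto
  then have "p3t (V \<union> S) E3 F3" using 3(1) by simp
  moreover have "V \<inter> S = {}" "E \<subseteq> E3"
    unfolding S_def using v 1(3) 2(3) 3(3) E0(1) E3 by auto
  ultimately show ?case using F3 unfolding R_def by blast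
qed

text \<open>The initial triangle has two faces; one copy is stacked and the other is left
  alone.\<close>

lemma planar_3_tree_deep:
  "\<exists>V E S. planar_3_tree V E \<and> S \<subseteq> V - {0, 1, 2} \<and> deep E d (0::nat) 1 2 S \<and> {0, 1, 2} \<subseteq> V"
proof -
  have "p3t {0::nat, 1, 2} {{0, 1}, {1, 2}, {0, 2}} {#{0, 1, 2}, {0, 1, 2}#}"
    by (rule p3t.base) auto
  from p3t_deepen[OF this, of 0 1 2 d] obtain E Fs and S :: "nat set" where
    "p3t ({0, 1, 2} \<union> S) E Fs" "{0, 1, 2} \<inter> S = {}" "deep E d 0 1 2 S" by auto
  then have "planar_3_tree ({0, 1, 2} \<union> S) E \<and> S \<subseteq> ({0, 1, 2} \<union> S) - {0, 1, 2} \<and> deep E d 0 1 2 S \<and> {0, 1, 2} \<subseteq> {0, 1, 2} \<union> S"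
    unfolding planar_3_tree_def by blast
  then show ?thesis by blast
qed

text \<open>Ensures that the \<open>LEAST\<close> in \<open>queue_number\<close> is attained. Every
  edge gets its own queue, and no edge is nested in itself.\<close>

lemma queue_layout_exists:
  assumes "finite V" "\<And>e. e \<in> E \<Longrightarrow> e \<subseteq> V"
  shows "\<exists>k vs q. queue_layout V E k vs q"
proof -
  obtain vs where vs: "distinct vs" "set vs = V"
    using finite_distinct_list[OF assms(1)] by blast
  have "finite E" using assms 
    by (intro finite_subset[of E "Pow V"]) auto
  then obtain q :: "'a set \<Rightarrow> nat" and k where q: "q ` E = {i. i < k}" "inj_on q E"
    using finite_imp_inj_to_nat_seg by blast
  have "False" if h: "{s1, t1} \<in> E" "{s2, t2} \<in> E" "q {s1, t1} = q {s2, t2}"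
     "prec vs s1 s2" "prec vs s2 t2" "prec vs t2 t1" for s1 t1 s2 t2
  proof -
    have index: "i = j" if "vs ! i = vs ! j" "i < length vs" "j < length vs" for i j
      using that nth_eq_iff_index_eq[OF vs(1)] by blast
    have irr: "x \<noteq> y" if "prec vs x y" for x y
      using that index unfolding prec_def by fastforce
    have trans: "prec vs x z" if "prec vs x y" "prec vs y z" for x y z
    proof -
      obtain i j where ij: "i < j" "j < length vs" "vs ! i = x" "vs ! j = y"
        using \<open>prec vs x y\<close> unfolding prec_def by blast
      obtain k l where kl: "k < l" "l < length vs" "vs ! k = y" "vs ! l = z"
        using \<open>prec vs y z\<close> unfolding prec_def by blast
      have "j = k" using index[of j k] ij kl by simp
      then show ?thesis unfolding prec_def using ij kl less_trans by blast
    qed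
    \<comment> \<open>Injectivity of \<open>q\<close> identifies the two edges, although
      \<open>s1\<close> strictly precedes both ends of the second.\<close>
    have "{s1, t1} = {s2, t2}" using h(1-3) q(2) by (simp add: inj_on_def)
    then have "s1 = s2 \<or> s1 = t2" by blast
    then show False using irr[OF h(4)] irr[OF trans[OF h(4,5)]] by blast
  qed
  moreover have "\<forall>e\<in>E. q e < k" using q(1) by auto
  ultimately have "queue_layout V E k vs q"
    unfolding queue_layout_def using vs by blast
  then show ?thesis by blast
qed

section \<open>The stacking game\<close>

text \<open>
  In a game position the vertices are integers whose order is the order of the layout. Only the order
  matters: the initial vertices are multiples of 16, which leaves enough room for midpoints. The list
  in a node gives the continuation for each position of the new vertex that does not immediately
  produce a rainbow.
\<close>

datatype strategy = Stack int int int "(int \<times> strategy) list"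

text \<open>
  Patience sorting: the $k$-th entry of the list is the innermost edge of a chain of $k$ nested edges.
\<close>

fun place :: "int \<times> int \<Rightarrow> (int \<times> int) list \<Rightarrow> (int \<times> int) list" where
  "place e [] = [e]"
| "place (a, b) ((c, d) # rs) =
     (if b < d \<and> c < a then (c, d) # place (a, b) rs else (a, b) # rs)"

definition rainbow :: "(int \<times> int) list \<Rightarrow> bool" where
  "rainbow es \<longleftrightarrow> (case fold place es [] of _ # _ # _ # _ # _ \<Rightarrow> True | _ \<Rightarrow> False)"

text \<open>
  Edges are kept in lexicographic order because only then does \<^const>\<open>rainbow\<close> find every rainbow; its
  soundness does not depend on the order.
\<close>

fun add_edge :: "int \<times> int \<Rightarrow> (int \<times> int) list \<Rightarrow> (int \<times> int) list" where
  "add_edge e [] = [e]"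
| "add_edge (a, b) ((c, d) # rs) =
     (if c < a then (c, d) # add_edge (a, b) rs
      else if a < c then (a, b) # (c, d) # rs
      else if d < b then (c, d) # add_edge (a, b) rs
      else if b < d then (a, b) # (c, d) # rs
      else (c, d) # rs)"

definition edge :: "int \<Rightarrow> int \<Rightarrow> int \<times> int" where
  "edge a b = (if a < b then (a, b) else (b, a))"

definition add_star :: "int \<Rightarrow> int \<Rightarrow> int \<Rightarrow> int \<Rightarrow> (int \<times> int) list \<Rightarrow> (int \<times> int) list" where
  "add_star p a b c es = add_edge (edge p a) (add_edge (edge p b) (add_edge (edge p c) es))"

text \<open>For \<open>a < b\<close> the triple comes out increasing. Every face thus has a single
  representation, so that membership and \<open>remove1\<close> in \<open>wins\<close> find
  it.\<close>

definition face :: "int \<Rightarrow> int \<Rightarrow> int \<Rightarrow> int \<times> int \<times> int" where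
  "face a b p = (if p < a then (p, a, b) else if p < b then (a, p, b) else (a, b, p))"

fun gaps_after :: "int \<Rightarrow> int list \<Rightarrow> int list" where
  "gaps_after x [] = [x + 16]"
| "gaps_after x (y # ys) = (x + y) div 2 # gaps_after y ys"

fun gaps :: "int list \<Rightarrow> int list" where
  "gaps [] = [0]"
| "gaps (x # xs) = (x - 16) # gaps_after x xs"

fun spaced :: "int list \<Rightarrow> bool" where
  "spaced (x # y # ys) \<longleftrightarrow> x + 1 < y \<and> spaced (y # ys)"
| "spaced _ \<longleftrightarrow> True"

text \<open>The number bounds both the moves left and the remaining depth of all open faces, so a
  strategy that is not finished at 0 fails. An empty list of continuations claims that every
  position of the new vertex completes a rainbow.\<close>

fun wins :: "nat \<Rightarrow> int list \<Rightarrow> (int \<times> int) list \<Rightarrow> (int \<times> int \<times> int) list \<Rightarrow> strategy \<Rightarrow> bool"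
where
  "wins 0 vs es fs t \<longleftrightarrow> False"
| "wins (Suc d) vs es fs (Stack a b c ts) \<longleftrightarrow>
     (a, b, c) \<in> set fs \<and> spaced vs \<and>
     list_all (\<lambda>p. p \<in> fst ` set ts \<or> rainbow (add_star p a b c es)) (gaps vs) \<and>
     list_all (\<lambda>(p, t). wins d (insort p vs) (add_star p a b c es)
       (face a b p # face b c p # face a c p # remove1 (a, b, c) fs) t) ts"

definition face_edges :: "(int \<times> int \<times> int) list \<Rightarrow> (int \<times> int) list" where
  "face_edges fs = fold (\<lambda>(a, b, c) es. add_edge (a, b) (add_edge (a, c) (add_edge (b, c) es))) fs []"

definition pair_faces :: "int \<Rightarrow> int \<Rightarrow> (int \<times> int) list \<Rightarrow> (int \<times> int \<times> int) list" where
  "pair_faces a b ps = concat (map (\<lambda>(y, z). [face y z a, face y z b]) ps)"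

section \<open>Winning strategies for the four configurations\<close>

definition across_strategy :: strategy where
  "across_strategy =
    Stack 48 112 192 []"

text \<open>From left to right: seven left ends, A = 112, B = 128, seven right ends. A single
  stacking into the face of the fourth pair and A already forces a rainbow.\<close>

lemma wins_across:
  "let fs = pair_faces 112 128
      [(0, 144), (16, 160), (32, 176), (48, 192), (64, 208), (80, 224), (96, 240)]
   in wins 7 (map ((*) 16) [0..15]) (face_edges fs) fs across_strategy"
  by code_simp

definition astride_strategy :: strategy where
  "astride_strategy =
    Stack 48 96 160 [(-16, Stack 32 144 208 [])]"

text \<open>From left to right: six left ends, A = 96, six right ends, B = 208. A second move is
  needed only if the new vertex is placed to the left of everything.\<close>

lemma wins_astride:
  "let fs = pair_faces 96 208
      [(0, 112), (16, 128), (32, 144), (48, 160), (64, 176), (80, 192)]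
   in wins 7 (map ((*) 16) [0..13]) (face_edges fs) fs astride_strategy"
  by code_simp

definition twisted_strategy :: strategy where
  "twisted_strategy =
    Stack 48 144 208 [(-16, Stack 32 128 192 [(-32, Stack 16 112 208 [(-24, Stack 16 112 192
    [(-28, Stack (-16) 48 144 [])])]), (-8, Stack 16 112 192 [])]), (8, Stack 32 128 192 [(-16,
    Stack 16 112 192 [(184, Stack 48 144 192 [])])]), (224, Stack 48 144 224 [])]"

text \<open>Six pairwise crossing pairs, followed by A = 192 and B = 208.\<close>

lemma wins_twisted:
  "let fs = pair_faces 192 208
      [(0, 96), (16, 112), (32, 128), (48, 144), (64, 160), (80, 176)]
   in wins 7 (map ((*) 16) [0..13]) (face_edges fs) fs twisted_strategy"
  by code_simp

definition separated_strategy :: strategy where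
  "separated_strategy =
    Stack 64 80 176 [(-16, Stack 64 80 160 [(-32, Stack (-16) 64 80 [(-48, Stack 32 48 160 [(8,
    Stack 8 32 160 []), (24, Stack 24 48 160 [(28, Stack 24 32 160 []), (40, Stack 32 48 176
    [])]), (40, Stack 32 48 176 [(36, Stack 32 40 160 []), (44, Stack 40 48 160 [])]), (56,
    Stack 32 56 160 [(40, Stack 32 48 176 []), (52, Stack 48 56 160 [])]), (72, Stack 48 72 160
    [])]), (40, Stack 40 64 80 []), (56, Stack 56 64 80 []), (72, Stack 64 72 80 [(-48, Stack
    (-48) 72 80 [])]), (88, Stack 64 80 88 []), (104, Stack (-16) 80 104 [])]), (-8, Stack 0 16
    160 [(-4, Stack (-4) 16 160 [(-2, Stack (-4) 0 160 []), (8, Stack (-4) 8 160 [])]), (8,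
    Stack 0 8 160 [(-4, Stack (-4) 0 160 [(-6, Stack (-4) 8 160 [])])]), (24, Stack 0 24 160
    [(8, Stack 8 24 160 []), (20, Stack 16 24 160 [])]), (40, Stack 16 40 160 [])]), (40, Stack
    40 64 160 [(-32, Stack 40 64 80 [(-48, Stack (-16) 64 80 [(88, Stack (-48) 64 80 []), (104,
    Stack (-48) 64 80 [])])]), (-8, Stack 40 64 80 [])]), (56, Stack 56 64 80 [(-32, Stack 56 80
    160 [(-24, Stack (-32) 64 80 []), (60, Stack 56 64 160 [(-24, Stack 56 60 80 [])]), (72,
    Stack 56 72 160 [])]), (-8, Stack (-16) 64 80 [(88, Stack (-8) 64 80 []), (104, Stack (-8)
    64 80 [])])]), (72, Stack 64 72 80 [(-32, Stack 64 72 160 [(-8, Stack (-32) 72 80 []), (40,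
    Stack 40 64 72 [(-48, Stack 40 64 160 [])]), (56, Stack 56 72 160 [(60, Stack 60 72 160
    [])])]), (-8, Stack 72 80 160 [(88, Stack 72 80 88 []), (104, Stack 72 80 104 [])])]), (88,
    Stack 64 80 88 [(-32, Stack (-32) 64 88 [(-24, Stack (-32) 80 88 [(-8, Stack 80 88 160 [(92,
    Stack (-8) 80 88 []), (104, Stack (-8) 80 88 [])])]), (72, Stack (-16) 64 80 []), (84, Stack
    (-32) 64 84 [])]), (-8, Stack 64 88 160 [(72, Stack 64 72 88 []), (84, Stack 80 88 160
    [])])]), (104, Stack 64 80 104 [(-32, Stack 80 104 160 [(-8, Stack (-32) 80 104 [])]), (-8,
    Stack 80 104 160 [])])]), (8, Stack 64 80 160 [(-16, Stack 8 64 80 [(-32, Stack 0 16 176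
    [(4, Stack 0 4 176 []), (12, Stack 0 12 176 []), (24, Stack 0 24 176 [(4, Stack 0 16 160
    []), (12, Stack 0 16 160 []), (20, Stack 16 24 176 [])]), (40, Stack 16 40 176 [])]), (40,
    Stack 40 64 80 [(-32, Stack 32 48 160 [])]), (56, Stack 56 64 80 []), (72, Stack 64 72 80
    [(-32, Stack (-32) 72 80 [])]), (88, Stack 64 80 88 []), (104, Stack 8 80 104 [])]), (40,
    Stack 40 64 80 [(-16, Stack (-16) 64 80 [(-32, Stack 40 64 160 []), (-8, Stack 40 64 160
    []), (88, Stack 64 80 88 []), (104, Stack 64 80 104 [])])]), (56, Stack 56 64 80 [(-16,
    Stack 56 80 160 [(-8, Stack (-16) 64 80 []), (60, Stack 56 64 160 [(-8, Stack 56 60 80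
    [])]), (72, Stack 56 72 160 [])])]), (72, Stack 64 72 80 [(-16, Stack 72 80 160 [(88, Stack
    (-16) 72 80 []), (104, Stack (-16) 72 80 [])])]), (88, Stack 64 80 88 [(-16, Stack 64 88 160
    [(-8, Stack 8 80 176 [(40, Stack 32 48 160 []), (92, Stack (-16) 80 88 []), (104, Stack
    (-16) 80 88 [])]), (72, Stack 64 72 88 []), (84, Stack 64 84 88 [])])]), (104, Stack 64 80
    104 [(-16, Stack 80 104 160 [(12, Stack (-16) 80 104 [])])])]), (40, Stack 40 64 176 [(-16,
    Stack (-16) 40 64 [(-32, Stack 32 48 160 [(8, Stack 32 48 176 []), (24, Stack 32 48 176 []),
    (36, Stack 36 48 160 [])]), (-8, Stack 40 64 80 [])]), (8, Stack 32 48 176 [(4, Stack 32 48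
    160 [(-16, Stack 8 40 64 [(-32, Stack 4 32 48 []), (6, Stack 4 32 48 []), (12, Stack 4 32 48
    [])])]), (12, Stack 32 48 160 [(-16, Stack 40 64 80 [])]), (24, Stack 32 48 160 [(-16, Stack
    40 64 80 [])]), (36, Stack 36 48 176 [])])]), (56, Stack 56 80 176 [(-16, Stack 56 64 80
    [(-32, Stack 64 80 160 [(-8, Stack (-32) 64 80 []), (88, Stack (-32) 64 80 [(-8, Stack 64 80
    88 [])]), (104, Stack (-32) 64 80 [(-8, Stack 64 80 104 [])])]), (-8, Stack 64 80 160 [(88,
    Stack 64 80 88 []), (104, Stack 64 80 104 [])])]), (8, Stack 56 64 80 [(-16, Stack 64 80 160
    [(88, Stack (-16) 64 80 []), (104, Stack (-16) 64 80 [])])]), (60, Stack 56 64 176 [(-16,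
    Stack 56 64 80 [(-32, Stack 56 60 80 []), (-8, Stack 56 60 80 [])]), (8, Stack 60 80 176
    [])]), (72, Stack 64 80 160 [(-16, Stack 56 64 80 [(-32, Stack 56 72 176 []), (-8, Stack 56
    72 80 []), (8, Stack 56 72 80 [])]), (8, Stack 56 72 176 [])])]), (72, Stack 64 80 160
    [(-16, Stack 72 80 176 [(-32, Stack 64 72 80 []), (-8, Stack 64 72 80 [(-32, Stack (-32) 72
    80 [])]), (8, Stack 64 72 80 [(-32, Stack (-32) 72 80 [])]), (88, Stack 64 72 80 [(-32,
    Stack 72 80 88 [(-8, Stack (-32) 72 80 []), (8, Stack (-32) 72 80 [])]), (-8, Stack 72 80 88
    []), (8, Stack 72 80 88 [])]), (104, Stack 72 80 104 [(-32, Stack 64 72 80 []), (-8, Stack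
    80 104 176 []), (8, Stack 80 104 176 [])])]), (8, Stack 72 80 176 [(88, Stack 64 72 80
    [(-16, Stack 72 80 88 [])]), (104, Stack 80 104 176 [])]), (68, Stack 64 72 80 [(-16, Stack
    64 72 176 [(-32, Stack 64 68 80 []), (-8, Stack 64 68 80 []), (8, Stack 64 68 80 [])]), (8,
    Stack 64 72 176 [])]), (76, Stack 64 72 80 [(-16, Stack 72 80 176 [(-32, Stack 64 76 80 []),
    (-8, Stack 64 76 160 []), (8, Stack 64 76 160 [])]), (8, Stack 72 80 176 [])])]), (88, Stack
    64 88 176 [(-16, Stack 64 80 88 [(-32, Stack 64 80 160 [(-8, Stack (-32) 80 88 []), (40,
    Stack 40 64 80 [(-48, Stack 40 64 160 [])]), (56, Stack 56 80 160 [(60, Stack 60 80 160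
    [])])]), (-8, Stack 80 88 176 [(92, Stack 80 88 92 []), (104, Stack 80 88 104 [])])]), (8,
    Stack 64 80 88 [(-16, Stack 80 88 176 [(92, Stack (-16) 80 88 []), (104, Stack (-16) 80 88
    [])])]), (72, Stack 64 80 160 [(-16, Stack 64 80 88 [(-32, Stack 64 72 88 []), (-8, Stack 64
    72 88 []), (8, Stack 64 72 88 [])]), (8, Stack 72 88 176 [])]), (84, Stack 80 88 176 [(-16,
    Stack 64 80 88 [(-32, Stack 64 84 176 []), (-8, Stack 64 84 88 [])]), (8, Stack 64 84 176
    [])])]), (104, Stack 80 104 176 [(-16, Stack 64 80 104 [(-32, Stack 64 104 176 [(-24, Stack
    (-16) 80 104 []), (72, Stack 64 80 160 [(-24, Stack (-16) 80 104 [])]), (88, Stack 64 88 176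
    [])]), (-8, Stack (-16) 80 104 [])]), (8, Stack 64 104 176 [(72, Stack 72 104 176 []), (88,
    Stack 64 88 176 [])])])]"

text \<open>Five pairs side by side, followed by A = 160 and B = 176. The pairs by themselves
  contain no nesting, and the strategy is by far the largest of the four.\<close>

lemma wins_separated:
  "let fs = pair_faces 160 176
      [(0, 16), (32, 48), (64, 80), (96, 112), (128, 144)]
   in wins 7 (map ((*) 16) [0..11]) (face_edges fs) fs separated_strategy"
  by code_simp

section \<open>Soundness of winning strategies\<close>

definition open_face :: "int set set \<Rightarrow> (int \<Rightarrow> int) \<Rightarrow> nat \<Rightarrow> int \<times> int \<times> int \<Rightarrow> int set \<Rightarrow> bool" where
  "open_face E \<sigma> d f S = (case f of (a, b, c) \<Rightarrow> deep E d (\<sigma> a) (\<sigma> b) (\<sigma> c) S)"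

lemma open_face_face: "deep E d (\<sigma> a) (\<sigma> b) (\<sigma> p) S \<Longrightarrow> open_face E \<sigma> d (face a b p) S"
  using deep_swap23[of E d "\<sigma> a" "\<sigma> b" "\<sigma> p" S] deep_swap12[of E d "\<sigma> a" "\<sigma> p" "\<sigma> b" S]
  by (auto simp: open_face_def face_def)

text \<open>The interiors of the listed faces are disjoint and contained in the pool $X$ of unused vertices.\<close>

fun open_faces :: "int set set \<Rightarrow> (int \<Rightarrow> int) \<Rightarrow> nat \<Rightarrow> (int \<times> int \<times> int) list \<Rightarrow> int set \<Rightarrow> bool" where
  "open_faces E \<sigma> d [] X \<longleftrightarrow> True"
| "open_faces E \<sigma> d (f # fs) X \<longleftrightarrow> (\<exists>S\<subseteq>X. open_face E \<sigma> d f S \<and> open_faces E \<sigma> d fs (X - S))"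

lemma open_faces_mono: "open_faces E \<sigma> d fs X \<Longrightarrow> X \<subseteq> Y \<Longrightarrow> open_faces E \<sigma> d fs Y"
proof (induction fs arbitrary: X Y)
  case (Cons f fs)
  then obtain S where S: "S \<subseteq> X" "open_face E \<sigma> d f S" "open_faces E \<sigma> d fs (X - S)" by auto
  have "X - S \<subseteq> Y - S" using Cons.prems by blast
  then have "open_faces E \<sigma> d fs (Y - S)" using Cons.IH S(3) by blast
  moreover have "S \<subseteq> Y" using S(1) Cons.prems by blast
  ultimately show ?case using S(2) by auto
qed simp

lemma open_faces_append:
  "open_faces E \<sigma> d fs X \<Longrightarrow> open_faces E \<sigma> d gs Y \<Longrightarrow> X \<inter> Y = {} \<Longrightarrow>
     open_faces E \<sigma> d (fs @ gs) (X \<union> Y)"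
proof (induction fs arbitrary: X)
  case Nil
  then show ?case using open_faces_mono by fastforce
next
  case (Cons f fs)
  then obtain S where S: "S \<subseteq> X" "open_face E \<sigma> d f S" "open_faces E \<sigma> d fs (X - S)" by auto
  have "(X - S) \<inter> Y = {}" using Cons.prems(3) by blast
  from Cons.IH[OF S(3) Cons.prems(2) this]
  have "open_faces E \<sigma> d (fs @ gs) (X \<union> Y - S)"
    by (rule open_faces_mono) (use S(1) Cons.prems(3) in blast)
  then show ?case using S(1,2) by auto
qed

lemma open_faces_remove1:
  "open_faces E \<sigma> d fs X \<Longrightarrow> f \<in> set fs \<Longrightarrow>
     \<exists>S\<subseteq>X. open_face E \<sigma> d f S \<and> open_faces E \<sigma> d (remove1 f fs) (X - S)"
proof (induction fs arbitrary: X)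
  case (Cons g fs)
  then obtain S where S: "S \<subseteq> X" "open_face E \<sigma> d g S" "open_faces E \<sigma> d fs (X - S)" by auto
  show ?case
  proof (cases "f = g")
    case True
    then show ?thesis using S by auto
  next
    case False
    then obtain T where T: "T \<subseteq> X - S" "open_face E \<sigma> d f T"
      "open_faces E \<sigma> d (remove1 f fs) (X - S - T)"
      using Cons.IH[OF S(3)] Cons.prems by auto
    have "X - S - T = X - T - S" "S \<subseteq> X - T" using S(1) T(1) by blast+
    then have "open_faces E \<sigma> d (remove1 f (g # fs)) (X - T)"
      using S(2) T(3) False by auto
    then show ?thesis using T(1,2) by blast
  qed
qed simp

text \<open>Needed when the embedding is extended to a new vertex: the faces already listed do not
  contain it.\<close>

lemma open_faces_cong:
  assumes "open_faces E \<sigma> d fs X" "\<And>a b c. (a, b, c) \<in> set fs \<Longrightarrow> \<sigma> a = \<tau> a \<and> \<sigma> b = \<tau> b \<and> \<sigma> c = \<tau> c"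
  shows "open_faces E \<tau> d fs X"
  using assms
proof (induction fs arbitrary: X)
  case (Cons f fs)
  then obtain S where S: "S \<subseteq> X" "open_face E \<sigma> d f S" "open_faces E \<sigma> d fs (X - S)" by auto
  obtain a b c where f: "f = (a, b, c)" by (cases f)
  have "open_face E \<tau> d f S" using S(2) Cons.prems(2)[of a b c] unfolding open_face_def f by simp
  moreover have "open_faces E \<tau> d fs (X - S)" 
    by (rule Cons.IH[OF S(3)]) (rule Cons.prems(2), simp)
  ultimately show ?case using S(1) by auto
qed simp

text \<open>Faces that are not chosen in a move give up one level, so that one counter serves all of
  them.\<close>

lemma open_faces_Suc: "open_faces E \<sigma> (Suc d) fs X \<Longrightarrow> open_faces E \<sigma> d fs X"
proof (induction fs arbitrary: X)
  case (Cons f fs)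
  then obtain S where S: "S \<subseteq> X" "open_face E \<sigma> (Suc d) f S" "open_faces E \<sigma> (Suc d) fs (X - S)" by auto
  have "open_face E \<sigma> d f S"
    using S(2) deep_Suc unfolding open_face_def by (cases f) (simp del: deep.simps)
  then show ?case using S(1) Cons.IH[OF S(3)] by auto
qed simp

lemma set_add_edge: "set (add_edge e es) = insert e (set es)"
  by (induction e es rule: add_edge.induct) auto

lemma spaced_Cons: "spaced (x # xs) \<Longrightarrow> spaced xs \<and> (\<forall>y\<in>set xs. x < y)"
proof (induction xs arbitrary: x)
  case (Cons y ys)
  then show ?case using Cons.IH[of y] by fastforce
qed simp

lemma gaps_after:
  fixes \<sigma> :: "int \<Rightarrow> int"
  assumes "spaced (x # xs)" "strict_mono_on (set (x # xs)) \<sigma>" "v \<notin> \<sigma> ` set (x # xs)" "\<sigma> x < v"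
  shows "\<exists>p\<in>set (gaps_after x xs). x < p \<and> (\<forall>y\<in>set xs. y \<noteq> p \<and> (y < p \<longleftrightarrow> \<sigma> y < v))"
  using assms
proof (induction xs arbitrary: x)
  case (Cons y ys)
  have sp: "x + 1 < y" "spaced (y # ys)" using Cons.prems(1) by simp_all
  show ?case
  proof (cases "\<sigma> y < v")
    case True
    have "strict_mono_on (set (y # ys)) \<sigma>"
      using Cons.prems(2) by (rule monotone_on_subset) auto
    then obtain p where "p \<in> set (gaps_after y ys)" "y < p" "\<forall>z\<in>set ys. z \<noteq> p \<and> (z < p \<longleftrightarrow> \<sigma> z < v)"
      using Cons.IH[OF sp(2)] Cons.prems(3) True by auto
    then show ?thesis using True sp(1) by (intro bexI[of _ p]) auto
  next
    case False
    then have lt: "v < \<sigma> y" using Cons.prems(3) by auto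
    define p where "p = (x + y) div 2"
    \<comment> \<open>The test \<open>spaced\<close> guarantees \<open>x + 1 < y\<close>, without
      which the integer midpoint could coincide with \<open>x\<close>.\<close>
    have p: "x < p" "p < y" using sp(1) unfolding p_def by linarith+
    have "z \<noteq> p \<and> (z < p \<longleftrightarrow> \<sigma> z < v)" if "z \<in> set (y # ys)" for z
    proof -
      have "y \<le> z" using that spaced_Cons[OF sp(2)] by auto
      moreover have "\<sigma> y \<le> \<sigma> z"
        using strict_mono_onD[OF Cons.prems(2), of y z] that \<open>y \<le> z\<close> by (cases "y = z") auto
      ultimately show ?thesis using p lt by auto
    qed
    then show ?thesis using p by (auto simp: p_def)
  qed
qed auto

text \<open>Completeness of the opponent's moves: wherever the new vertex \<open>v\<close> really
  lies, some representative in \<open>gaps vs\<close> has the same position relative to all earlier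
  vertices.\<close>

lemma gaps:
  fixes \<sigma> :: "int \<Rightarrow> int"
  assumes "spaced vs" "strict_mono_on (set vs) \<sigma>" "v \<notin> \<sigma> ` set vs"
  shows "\<exists>p\<in>set (gaps vs). \<forall>y\<in>set vs. y \<noteq> p \<and> (y < p \<longleftrightarrow> \<sigma> y < v)"
proof (cases vs)
  case (Cons x xs)
  show ?thesis
  proof (cases "\<sigma> x < v")
    case True
    from gaps_after[OF assms[unfolded Cons] this] show ?thesis
      using True Cons by auto
  next
    case False
    then have lt: "v < \<sigma> x" using assms(3) Cons by auto
    have "y \<noteq> x - 16 \<and> (y < x - 16 \<longleftrightarrow> \<sigma> y < v)" if "y \<in> set vs" for y
    proof -
      have "x \<le> y" using that spaced_Cons assms(1) Cons by fastforce
      moreover have "\<sigma> x \<le> \<sigma> y"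
        using strict_mono_onD[OF assms(2), of x y] that \<open>x \<le> y\<close> Cons by (cases "x = y") auto
      ultimately show ?thesis using lt by auto
    qed
    then show ?thesis using Cons by simp
  qed
qed simp

section \<open>Three-queue layouts with vertices identified with their positions\<close>

locale three_queue =
  fixes E :: "int set set" and q :: "int set \<Rightarrow> nat"
  assumes q_less: "e \<in> E \<Longrightarrow> q e < 3"
    and q_nested: "\<lbrakk>{s1, t1} \<in> E; {s2, t2} \<in> E; s1 < s2; s2 < t2; t2 < t1\<rbrakk> \<Longrightarrow> q {s1, t1} \<noteq> q {s2, t2}"
begin

lemma no_rainbow:
  assumes "{a1, b1} \<in> E" "{a2, b2} \<in> E" "{a3, b3} \<in> E" "{a4, b4} \<in> E"
    and "a1 < a2" "a2 < a3" "a3 < a4" "a4 < b4" "b4 < b3" "b3 < b2" "b2 < b1"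
  shows False
proof -
  have "q {a1, b1} \<noteq> q {a2, b2}" "q {a1, b1} \<noteq> q {a3, b3}" "q {a1, b1} \<noteq> q {a4, b4}"
    "q {a2, b2} \<noteq> q {a3, b3}" "q {a2, b2} \<noteq> q {a4, b4}" "q {a3, b3} \<noteq> q {a4, b4}"
    by (rule q_nested; insert assms; (assumption | linarith))+
  moreover have "q {a1, b1} < 3" "q {a2, b2} < 3" "q {a3, b3} < 3" "q {a4, b4} < 3"
    using assms q_less by auto
  ultimately show False by linarith
qed

text \<open>A chain of \<open>n + 1\<close> nested edges whose innermost edge is
  \<open>{a, b}\<close>.\<close>

fun enclosed :: "nat \<Rightarrow> int \<Rightarrow> int \<Rightarrow> bool" where
  "enclosed 0 a b \<longleftrightarrow> {a, b} \<in> E"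
| "enclosed (Suc n) a b \<longleftrightarrow> {a, b} \<in> E \<and> (\<exists>a' b'. enclosed n a' b' \<and> a' < a \<and> b < b')"

lemma enclosed_3: "enclosed 3 a b \<Longrightarrow> a < b \<Longrightarrow> False"
  using no_rainbow by (auto simp: numeral_3_eq_3)

definition sound_edge :: "(int \<Rightarrow> int) \<Rightarrow> int set \<Rightarrow> int \<times> int \<Rightarrow> bool" where
  "sound_edge \<sigma> V e \<longleftrightarrow> fst e \<in> V \<and> snd e \<in> V \<and> fst e < snd e \<and> {\<sigma> (fst e), \<sigma> (snd e)} \<in> E"

fun sound_piles :: "(int \<Rightarrow> int) \<Rightarrow> int set \<Rightarrow> nat \<Rightarrow> (int \<times> int) list \<Rightarrow> bool" where
  "sound_piles \<sigma> V n [] \<longleftrightarrow> True"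
| "sound_piles \<sigma> V n (e # es) \<longleftrightarrow>
     sound_edge \<sigma> V e \<and> enclosed n (\<sigma> (fst e)) (\<sigma> (snd e)) \<and> sound_piles \<sigma> V (Suc n) es"

text \<open>An edge moves past an entry only if it is strictly nested in it, and that entry then
  extends the chain around it by one. Hence, wherever the edge finally comes to rest, it is enclosed
  by as many edges as the index of its pile says.\<close>

lemma sound_piles_place:
  assumes "strict_mono_on V \<sigma>"
  shows "sound_edge \<sigma> V e \<Longrightarrow> enclosed n (\<sigma> (fst e)) (\<sigma> (snd e)) \<Longrightarrow> sound_piles \<sigma> V n ps \<Longrightarrow>
    sound_piles \<sigma> V n (place e ps)"
proof (induction e ps arbitrary: n rule: place.induct)
  case (2 a b c d rs)
  show ?case
  proof (cases "b < d \<and> c < a")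
    case True
    then have "enclosed (Suc n) (\<sigma> a) (\<sigma> b)"
      using "2.prems" strict_mono_onD[OF assms] by (auto simp: sound_edge_def)
    then show ?thesis using 2 True by simp
  next
    case False
    then show ?thesis using "2.prems" by (auto simp del: enclosed.simps)
  qed
qed simp

lemma sound_piles_fold:
  assumes "strict_mono_on V \<sigma>"
  shows "\<forall>e\<in>set es. sound_edge \<sigma> V e \<Longrightarrow> sound_piles \<sigma> V 0 ps \<Longrightarrow> sound_piles \<sigma> V 0 (fold place es ps)"
proof (induction es arbitrary: ps)
  case (Cons e es)
  have "sound_piles \<sigma> V 0 (place e ps)"
    using sound_piles_place[OF assms, of e 0 ps] Cons.prems by (simp add: sound_edge_def)
  then show ?case using Cons by simp
qed simp

lemma rainbow_False:
  assumes "rainbow es" "strict_mono_on V \<sigma>" "\<forall>e\<in>set es. sound_edge \<sigma> V e"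
  shows False
proof -
  obtain e1 e2 e3 e4 ps where "fold place es [] = e1 # e2 # e3 # e4 # ps"
    using assms(1) unfolding rainbow_def by (auto split: list.splits)
  then have "sound_edge \<sigma> V e4" "enclosed 3 (\<sigma> (fst e4)) (\<sigma> (snd e4))"
    using sound_piles_fold[OF assms(2,3), of "[]"] by (simp_all add: numeral_3_eq_3)
  then show False using enclosed_3 strict_mono_onD[OF assms(2)] unfolding sound_edge_def by blast
qed

lemma sound_edge_edge:
  "\<lbrakk>a \<in> V; p \<in> V; a \<noteq> p; {\<sigma> a, \<sigma> p} \<in> E\<rbrakk> \<Longrightarrow> sound_edge \<sigma> V (edge p a)"
  by (auto simp: sound_edge_def edge_def insert_commute)

text \<open>The map \<open>\<sigma>\<close> embeds the abstract position into the actual layout;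
  \<open>X\<close> is the pool from which the vertices of future moves are taken.\<close>

definition realizes :: "(int \<Rightarrow> int) \<Rightarrow> nat \<Rightarrow> int set \<Rightarrow> (int \<times> int) list \<Rightarrow> (int \<times> int \<times> int) list \<Rightarrow> bool"
where
  "realizes \<sigma> d V es fs \<longleftrightarrow> strict_mono_on V \<sigma> \<and> (\<forall>e\<in>set es. sound_edge \<sigma> V e) \<and>
     (\<forall>(a, b, c)\<in>set fs. {a, b, c} \<subseteq> V) \<and> (\<exists>X. X \<inter> \<sigma> ` V = {} \<and> open_faces E \<sigma> d fs X)"

text \<open>A realized position is transported along one move: the vertex stacked into the chosen
  face exists by depth, its gap \<open>p\<close> becomes a new abstract vertex, and the strategy
  supplies a continuation because the layout has no rainbow. After finitely many moves the counter
  reaches 0, where nothing wins.\<close>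

lemma wins_False: "wins d vs es fs t \<Longrightarrow> realizes \<sigma> d (set vs) es fs \<Longrightarrow> False"
proof (induction d arbitrary: vs es fs t \<sigma>)
  case (Suc d)
  obtain a b c ts where t: "t = Stack a b c ts" by (cases t)
  have w: "(a, b, c) \<in> set fs" "spaced vs"
    "\<And>p. p \<in> set (gaps vs) \<Longrightarrow> p \<in> fst ` set ts \<or> rainbow (add_star p a b c es)"
    "\<And>p t. (p, t) \<in> set ts \<Longrightarrow> wins d (insort p vs) (add_star p a b c es)
       (face a b p # face b c p # face a c p # remove1 (a, b, c) fs) t"
    using Suc.prems(1) unfolding t by (auto simp: list_all_iff)
  obtain X where r: "strict_mono_on (set vs) \<sigma>" "\<forall>e\<in>set es. sound_edge \<sigma> (set vs) e"
    "\<forall>(a, b, c)\<in>set fs. {a, b, c} \<subseteq> set vs" "X \<inter> \<sigma> ` set vs = {}" "open_faces E \<sigma> (Suc d) fs X"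
    using Suc.prems(2) unfolding realizes_def by blast
  obtain S where S: "S \<subseteq> X" "open_face E \<sigma> (Suc d) (a, b, c) S"
    "open_faces E \<sigma> (Suc d) (remove1 (a, b, c) fs) (X - S)"
    using open_faces_remove1[OF r(5) w(1)] by blast
  have "deep E (Suc d) (\<sigma> a) (\<sigma> b) (\<sigma> c) S" using S(2) unfolding open_face_def by simp
  then obtain v S1 S2 S3 where v: "v \<in> S" "S1 \<subseteq> S - {v}" "S2 \<subseteq> S - {v}" "S3 \<subseteq> S - {v}"
    "S1 \<inter> S2 = {}" "S2 \<inter> S3 = {}" "S1 \<inter> S3 = {}"
    "deep E d (\<sigma> a) (\<sigma> b) v S1" "deep E d (\<sigma> b) (\<sigma> c) v S2" "deep E d (\<sigma> a) (\<sigma> c) v S3"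
    by (rule deep_stack)
  have "v \<notin> \<sigma> ` set vs" using v(1) S(1) r(4) by blast
  with gaps[OF w(2) r(1)] obtain p where p: "p \<in> set (gaps vs)"
    "\<And>y. y \<in> set vs \<Longrightarrow> y \<noteq> p \<and> (y < p \<longleftrightarrow> \<sigma> y < v)" by blast
  \<comment> \<open>The new abstract vertex \<open>p\<close> is mapped to the actual vertex
    \<open>v\<close>; the choice of the gap makes the extended map strictly increasing
    again.\<close>
  define V where "V = insert p (set vs)"
  define \<tau> where "\<tau> = \<sigma>(p := v)"
  have \<tau>: "\<tau> p = v" "\<And>y. y \<in> set vs \<Longrightarrow> \<tau> y = \<sigma> y" using p(2) unfolding \<tau>_def by auto
  have abc: "a \<in> set vs" "b \<in> set vs" "c \<in> set vs" using r(3) w(1) by auto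
  have mono: "strict_mono_on V \<tau>"
  proof (rule strict_mono_onI)
    fix x y assume "x \<in> V" "y \<in> V" "x < y"
    then consider "x \<in> set vs" "y \<in> set vs" | "x = p" "y \<in> set vs" | "x \<in> set vs" "y = p"
      unfolding V_def by auto
    then show "\<tau> x < \<tau> y"
    proof cases
      case 1
      then show ?thesis using \<tau>(2) strict_mono_onD[OF r(1)] \<open>x < y\<close> by simp
    next
      case 2
      then have "\<not> \<sigma> y < v" "\<sigma> y \<noteq> v" using p(2)[of y] \<open>x < y\<close> \<open>v \<notin> \<sigma> ` set vs\<close> by auto
      then show ?thesis using 2 \<tau> by simp
    next
      case 3
      then show ?thesis using p(2)[of x] \<open>x < y\<close> \<tau> by simp
    qed
  qed
  have star: "{\<tau> a, \<tau> p} \<in> E" "{\<tau> b, \<tau> p} \<in> E" "{\<tau> c, \<tau> p} \<in> E"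
    using deep_edges[OF v(8)] deep_edges[OF v(9)] \<tau> abc by auto
  have "sound_edge \<tau> V e" if "e \<in> set es" for e
  proof -
    have "sound_edge \<sigma> (set vs) e" using r(2) that by blast
    then show ?thesis using \<tau>(2) unfolding sound_edge_def V_def by auto
  qed
  moreover have "sound_edge \<tau> V (edge p a)" "sound_edge \<tau> V (edge p b)" "sound_edge \<tau> V (edge p c)"
    using abc star p(2) by (auto intro!: sound_edge_edge simp: V_def)
  ultimately have edges: "\<forall>e\<in>set (add_star p a b c es). sound_edge \<tau> V e"
    by (auto simp: add_star_def set_add_edge)
  then have "\<not> rainbow (add_star p a b c es)" using rainbow_False mono by blast
  then obtain t' where t': "(p, t') \<in> set ts" using w(3)[OF p(1)] by auto
  let ?rest = "remove1 (a, b, c) fs"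
  have rest: "{x, y, z} \<subseteq> set vs" if "(x, y, z) \<in> set ?rest" for x y z
    using that r(3) notin_set_remove1 by fastforce
  have "open_faces E \<tau> (Suc d) ?rest (X - S)"
    using S(3) by (rule open_faces_cong) (use rest \<tau>(2) in auto)
  then have "open_faces E \<tau> d ?rest (X - S)" by (rule open_faces_Suc)
  \<comment> \<open>The removed sets all lie in the interior \<open>S\<close> of the chosen face,
    which the other faces do not use.\<close>
  then have "open_faces E \<tau> d ?rest (X - {v} - S1 - S2 - S3)"
    by (rule open_faces_mono) (use v(1-4) in blast)
  moreover have "open_face E \<tau> d (face a b p) S1" "open_face E \<tau> d (face b c p) S2"
    "open_face E \<tau> d (face a c p) S3"
    using v(8-10) \<tau> abc by (auto intro!: open_face_face)
  moreover have "S1 \<subseteq> X - {v}" "S2 \<subseteq> X - {v} - S1" "S3 \<subseteq> X - {v} - S1 - S2"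
    using v(2-7) S(1) by blast+
  ultimately have faces: "open_faces E \<tau> d (face a b p # face b c p # face a c p # ?rest) (X - {v})"
    by auto
  have "(X - {v}) \<inter> \<tau> ` V = {}" using r(4) \<tau> unfolding V_def by auto
  moreover have "\<forall>(x, y, z)\<in>set (face a b p # face b c p # face a c p # ?rest). {x, y, z} \<subseteq> V"
    using abc rest unfolding V_def by (auto simp: face_def split: if_splits)
  ultimately have "realizes \<tau> d V (add_star p a b c es) (face a b p # face b c p # face a c p # ?rest)"
    unfolding realizes_def using mono edges faces by blast
  moreover have "set (insort p vs) = V" unfolding V_def by (simp add: set_insort_key)
  ultimately show False using Suc.IH[OF w(4)[OF t']] by simp
qed simp

end

section \<open>Pairs of common neighbours\<close>

text \<open>The set \<open>C\<close> is a private territory: it holds \<open>y\<close>,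
  \<open>z\<close> and the interiors of both faces at the edge \<open>y z\<close>. Disjoint
  territories therefore give distinct vertices and disjoint interiors at once.\<close>

definition flanked :: "'a set set \<Rightarrow> nat \<Rightarrow> 'a \<Rightarrow> 'a \<Rightarrow> 'a \<Rightarrow> 'a \<Rightarrow> 'a set \<Rightarrow> bool" where
  "flanked E d a b y z C \<longleftrightarrow> y \<in> C \<and> z \<in> C \<and> y \<noteq> z \<and>
     (\<exists>S\<subseteq>C - {y, z}. \<exists>T\<subseteq>C - {y, z}. S \<inter> T = {} \<and> deep E d y z a S \<and> deep E d y z b T)"

lemma flanked_swap:
  assumes "flanked E d a b y z C"
  shows "flanked E d a b z y C"
proof -
  obtain S T where "S \<subseteq> C - {z, y}" "T \<subseteq> C - {z, y}" "S \<inter> T = {}"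
    "deep E d z y a S" "deep E d z y b T" "y \<in> C" "z \<in> C" "z \<noteq> y"
    using assms deep_swap12 unfolding flanked_def insert_commute[of y z] by metis
  then show ?thesis unfolding flanked_def by blast
qed

lemma flanked_le:
  assumes "flanked E d' a b y z C" "d \<le> d'"
  shows "flanked E d a b y z C"
proof -
  obtain S T where *: "S \<subseteq> C - {y, z}" "T \<subseteq> C - {y, z}" "S \<inter> T = {}"
    "deep E d' y z a S" "deep E d' y z b T" "y \<in> C" "z \<in> C" "y \<noteq> z"
    using assms(1) unfolding flanked_def by blast
  have "deep E d y z a S" "deep E d y z b T"
    using deep_le[OF *(4) assms(2)] deep_le[OF *(5) assms(2)] by this
  then show ?thesis using *(1-3,6-8) unfolding flanked_def by blast
qed

text \<open>Reversal of the order exchanges \<open>a\<close> with \<open>b\<close> and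
  \<open>y\<close> with \<open>z\<close>, so that the left end stays on the left.\<close>

lemma flanked_uminus:
  fixes E :: "int set set"
  assumes "flanked E d a b y z C"
  shows "flanked ((`) uminus ` E) d (- b) (- a) (- z) (- y) (uminus ` C)"
proof -
  obtain S T where *: "S \<subseteq> C - {y, z}" "T \<subseteq> C - {y, z}" "S \<inter> T = {}"
    "deep E d y z a S" "deep E d y z b T" "y \<in> C" "z \<in> C" "y \<noteq> z"
    using assms unfolding flanked_def by blast
  have E: "{- u, - v} \<in> (`) uminus ` E" if "{u, v} \<in> E" for u v
    using imageI[OF that, of "(`) uminus"] by simp
  have "deep ((`) uminus ` E) d (- z) (- y) (- a) (uminus ` S)"
    "deep ((`) uminus ` E) d (- z) (- y) (- b) (uminus ` T)"
    by (rule deep_swap12, rule deep_image[OF *(4)], simp, erule E)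
      (rule deep_swap12, rule deep_image[OF *(5)], simp, erule E)
  moreover have "uminus ` S \<subseteq> uminus ` C - {- z, - y}" "uminus ` T \<subseteq> uminus ` C - {- z, - y}"
    "uminus ` T \<inter> uminus ` S = {}"
    using *(1-3) by auto
  ultimately show ?thesis unfolding flanked_def using *(6-8) by auto
qed

text \<open>Stack \<open>y\<close> into \<open>a b c\<close> and then \<open>z\<close> into
  \<open>a b y\<close>. The faces \<open>a y z\<close> and \<open>b y z\<close> flank the pair, and
  \<open>a b z\<close> is kept for further pairs.\<close>

lemma deep_pair:
  assumes "deep E (Suc (Suc d)) a b c S"
  shows "\<exists>y z C S'. flanked E d a b y z C \<and> C \<subseteq> S \<and> S' \<subseteq> S \<and> C \<inter> S' = {} \<and> deep E d a b z S'"
proof -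
  obtain y S1 where y: "y \<in> S" "S1 \<subseteq> S - {y}" "deep E (Suc d) a b y S1"
    using assms by (rule deep_stack)
  obtain z T1 T2 T3 where z: "z \<in> S1" "T1 \<subseteq> S1 - {z}" "T2 \<subseteq> S1 - {z}" "T3 \<subseteq> S1 - {z}"
    "T1 \<inter> T2 = {}" "T2 \<inter> T3 = {}" "T1 \<inter> T3 = {}"
    "deep E d a b z T1" "deep E d b y z T2" "deep E d a y z T3"
    using y(3) by (rule deep_stack)
  let ?C = "{y, z} \<union> T2 \<union> T3"
  have "deep E d y z a T3" "deep E d y z b T2"
    using deep_swap23[OF deep_swap12[OF z(10)]] deep_swap23[OF deep_swap12[OF z(9)]] by this
  moreover have "T3 \<subseteq> ?C - {y, z}" "T2 \<subseteq> ?C - {y, z}" "T3 \<inter> T2 = {}" "y \<noteq> z"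
    using y(2) z(1-7) by auto
  ultimately have "flanked E d a b y z ?C"
    unfolding flanked_def by blast
  moreover have "?C \<subseteq> S" "T1 \<subseteq> S" "?C \<inter> T1 = {}" using y(1,2) z(1-7) by auto
  ultimately show ?thesis using z(8) by blast
qed

text \<open>Each round of \<open>deep_pair\<close> costs two levels and continues in the face
  \<open>a b z\<close>, whose interior avoids the territory of the pair just found.\<close>

lemma deep_pairs:
  assumes "deep E (d + 2 * n) a b c S"
  shows "\<exists>y z C. (\<forall>i<n. flanked E d a b (y i) (z i) (C i) \<and> C i \<subseteq> S) \<and>
    (\<forall>i<n. \<forall>j<n. i \<noteq> j \<longrightarrow> C i \<inter> C j = {})"
  using assms
proof (induction n arbitrary: c S)
  case (Suc n)
  have "deep E (Suc (Suc (d + 2 * n))) a b c S" using Suc.prems by (simp only: mult_Suc_right add_2_eq_Suc add_Suc_right)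
  from deep_pair[OF this] obtain y0 z0 C0 S' where 0: "flanked E (d + 2 * n) a b y0 z0 C0"
    "C0 \<subseteq> S" "S' \<subseteq> S" "C0 \<inter> S' = {}" "deep E (d + 2 * n) a b z0 S'" by blast
  from Suc.IH[OF 0(5)] obtain y z C where
    IH: "\<forall>i<n. flanked E d a b (y i) (z i) (C i) \<and> C i \<subseteq> S'"
      "\<forall>i<n. \<forall>j<n. i \<noteq> j \<longrightarrow> C i \<inter> C j = {}"
    by (elim exE conjE)
  define y' z' C' where defs: "y' = case_nat y0 y" "z' = case_nat z0 z" "C' = case_nat C0 C"
  have flank: "flanked E d a b y0 z0 C0" using 0(1) by (rule flanked_le) simp
  have "flanked E d a b (y' i) (z' i) (C' i) \<and> C' i \<subseteq> S" if "i < Suc n" for i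
    using that flank IH(1) 0(2,3) by (cases i) (auto simp: defs)
  moreover have "C' i \<inter> C' j = {}" if "i < Suc n" "j < Suc n" "i \<noteq> j" for i j
  proof -
    have "C k \<inter> C0 = {}" if "k < n" for k using IH(1) that 0(4) by blast
    then show ?thesis using that IH(2) by (cases i; cases j) (auto simp: defs)
  qed
  ultimately show ?case by blast
qed simp

lemma pair_faces_Cons: "pair_faces a b ((y, z) # ps) = [face y z a, face y z b] @ pair_faces a b ps"
  by (simp add: pair_faces_def)

lemma open_faces_pairs:
  assumes "\<And>i. i < length ps \<Longrightarrow> flanked E d (\<sigma> a) (\<sigma> b) (\<sigma> (fst (ps ! i))) (\<sigma> (snd (ps ! i))) (C i)"
    and "\<And>i j. i < length ps \<Longrightarrow> j < length ps \<Longrightarrow> i \<noteq> j \<Longrightarrow> C i \<inter> C j = {}"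
  shows "open_faces E \<sigma> d (pair_faces a b ps)
    (\<Union>i<length ps. C i - {\<sigma> (fst (ps ! i)), \<sigma> (snd (ps ! i))})"
  using assms
proof (induction ps arbitrary: C)
  case Nil
  then show ?case by (simp add: pair_faces_def)
next
  case (Cons p ps)
  obtain y z where p: "p = (y, z)" by (cases p)
  have 0: "flanked E d (\<sigma> a) (\<sigma> b) (\<sigma> y) (\<sigma> z) (C 0)" using Cons.prems(1)[of 0] p by simp
  let ?X = "C 0 - {\<sigma> y, \<sigma> z}"
  let ?Y = "\<Union>i<length ps. C (Suc i) - {\<sigma> (fst (ps ! i)), \<sigma> (snd (ps ! i))}"
  obtain S T where ST: "S \<subseteq> ?X" "T \<subseteq> ?X" "S \<inter> T = {}" "deep E d (\<sigma> y) (\<sigma> z) (\<sigma> a) S"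
    "deep E d (\<sigma> y) (\<sigma> z) (\<sigma> b) T"
    using 0 unfolding flanked_def by (elim exE conjE)
  have "T \<subseteq> ?X - S" using ST(2,3) by blast
  then have "open_faces E \<sigma> d [face y z b] (?X - S)"
    using open_face_face[of E d \<sigma> y z b T] ST(5) by (simp only: open_faces.simps) blast
  then have "open_faces E \<sigma> d [face y z a, face y z b] ?X"
    using open_face_face[of E d \<sigma> y z a S] ST(4,1) by (simp only: open_faces.simps) blast
  moreover have "open_faces E \<sigma> d (pair_faces a b ps) ?Y"
  proof (rule Cons.IH)
    show "flanked E d (\<sigma> a) (\<sigma> b) (\<sigma> (fst (ps ! i))) (\<sigma> (snd (ps ! i))) (C (Suc i))"
      if "i < length ps" for i using Cons.prems(1)[of "Suc i"] that by simp
    show "C (Suc i) \<inter> C (Suc j) = {}" if "i < length ps" "j < length ps" "i \<noteq> j" for i j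
      using Cons.prems(2)[of "Suc i" "Suc j"] that by simp
  qed
  moreover have "?X \<inter> ?Y = {}"
  proof -
    have "C 0 \<inter> C (Suc i) = {}" if "i < length ps" for i
      using Cons.prems(2)[of 0 "Suc i"] that by simp
    then show ?thesis by blast
  qed
  ultimately have "open_faces E \<sigma> d (pair_faces a b (p # ps)) (?X \<union> ?Y)"
    unfolding p pair_faces_Cons by (rule open_faces_append)
  then show ?case
    by (rule open_faces_mono) (auto simp: p lessThan_Suc_eq_insert_0)
qed

lemma set_fold_add_edge:
  "set (fold (\<lambda>(a, b, c) es. add_edge (a, b) (add_edge (a, c) (add_edge (b, c) es))) fs es) =
     set es \<union> (\<Union>(a, b, c)\<in>set fs. {(a, b), (a, c), (b, c)})"
  by (induction fs arbitrary: es) (auto simp: set_add_edge)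

lemma set_face_edges: "set (face_edges fs) = (\<Union>(a, b, c)\<in>set fs. {(a, b), (a, c), (b, c)})"
  by (simp add: face_edges_def set_fold_add_edge)

lemma three_queue_uminus:
  assumes "three_queue E q"
  shows "three_queue ((`) uminus ` E) (q \<circ> (`) uminus)"
proof
  interpret three_queue E q by (rule assms)
  fix e assume "e \<in> (`) uminus ` E"
  then show "(q \<circ> (`) uminus) e < 3" using q_less by (auto simp: image_image)
next
  interpret three_queue E q by (rule assms)
  have E: "{- u, - v} \<in> E" if uv: "{u, v} \<in> (`) uminus ` E" for u v
  proof -
    obtain e where "e \<in> E" "{u, v} = uminus ` e" using uv by blast
    then have "uminus ` {u, v} = e" by (simp add: image_image)
    then show ?thesis using \<open>e \<in> E\<close> by simp
  qed
  fix s1 t1 s2 t2 :: int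
  assume "{s1, t1} \<in> (`) uminus ` E" "{s2, t2} \<in> (`) uminus ` E" "s1 < s2" "s2 < t2" "t2 < t1"
  then have "q {- t1, - s1} \<noteq> q {- t2, - s2}"
    using E by (intro q_nested) (auto simp: insert_commute)
  then show "(q \<circ> (`) uminus) {s1, t1} \<noteq> (q \<circ> (`) uminus) {s2, t2}"
    by (simp add: insert_commute)
qed

context three_queue
begin

text \<open>A family of flanked pairs placed as in the initial position realizes it: the pool
  consists of the territories without the pairs themselves, and the depth of the faces yields all
  initial edges.\<close>

lemma wins_pairs_False:
  assumes wins: "wins d vs (face_edges (pair_faces a b ps)) (pair_faces a b ps) t"
    and mono: "strict_mono_on (set vs) \<sigma>"
    and verts: "set vs = {a, b} \<union> fst ` set ps \<union> snd ` set ps"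
    and ord: "\<forall>(y, z)\<in>set ps. y < z \<and> a \<noteq> y \<and> a \<noteq> z \<and> b \<noteq> y \<and> b \<noteq> z"
    and flank: "\<And>i. i < length ps \<Longrightarrow> flanked E d (\<sigma> a) (\<sigma> b) (\<sigma> (fst (ps ! i))) (\<sigma> (snd (ps ! i))) (C i)"
    and ab: "\<And>i. i < length ps \<Longrightarrow> \<sigma> a \<notin> C i \<and> \<sigma> b \<notin> C i"
    and disj: "\<And>i j. i < length ps \<Longrightarrow> j < length ps \<Longrightarrow> i \<noteq> j \<Longrightarrow> C i \<inter> C j = {}"
  shows False
proof -
  define X where "X = (\<Union>i<length ps. C i - {\<sigma> (fst (ps ! i)), \<sigma> (snd (ps ! i))})"
  let ?fs = "pair_faces a b ps"
  have faces: "open_faces E \<sigma> d ?fs X"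
    unfolding X_def using flank disj by (rule open_faces_pairs)
  \<comment> \<open>A placed vertex is \<open>a\<close> or \<open>b\<close>, which lie in no
    territory, or an end of some pair. In the latter case disjointness identifies the two
    territories, and the ends have been taken out of the pool.\<close>
  have "x \<noteq> \<sigma> v" if "x \<in> X" "v \<in> set vs" for x v
  proof
    assume "x = \<sigma> v"
    obtain i where i: "i < length ps" "x \<in> C i" "x \<noteq> \<sigma> (fst (ps ! i))" "x \<noteq> \<sigma> (snd (ps ! i))"
      using \<open>x \<in> X\<close> unfolding X_def by blast
    have "v \<noteq> a" "v \<noteq> b" using ab[OF i(1)] i(2) \<open>x = \<sigma> v\<close> by auto
    then obtain p where "p \<in> set ps" "v = fst p \<or> v = snd p" using \<open>v \<in> set vs\<close> verts by auto
    then obtain j where j: "j < length ps" "v = fst (ps ! j) \<or> v = snd (ps ! j)"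
      by (metis in_set_conv_nth)
    have "\<sigma> v \<in> C j" using flank[OF j(1)] j(2) unfolding flanked_def by auto
    then have "i = j" using disj[OF i(1) j(1)] i(2) \<open>x = \<sigma> v\<close> by auto
    then show False using i(3,4) j(2) \<open>x = \<sigma> v\<close> by auto
  qed
  then have X: "X \<inter> \<sigma> ` set vs = {}" by auto
  have fs: "x < y \<and> y < z \<and> {x, y, z} \<subseteq> set vs" if xyz: "(x, y, z) \<in> set ?fs" for x y z
  proof -
    obtain u v w where uvw: "(u, v) \<in> set ps" "w = a \<or> w = b" "(x, y, z) = face u v w"
      using xyz unfolding pair_faces_def by auto
    have "u \<in> fst ` set ps" "v \<in> snd ` set ps" using uvw(1) by force+
    then have "u \<in> set vs" "v \<in> set vs" "w \<in> set vs" using uvw(2) verts by auto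
    moreover have "u < v" "w \<noteq> u" "w \<noteq> v" using uvw(1,2) ord by auto
    ultimately show ?thesis using uvw(3) by (auto simp: face_def split: if_splits)
  qed
  have "{\<sigma> x, \<sigma> y} \<in> E \<and> {\<sigma> x, \<sigma> z} \<in> E \<and> {\<sigma> y, \<sigma> z} \<in> E" if xyz: "(x, y, z) \<in> set ?fs" for x y z
  proof -
    obtain S where "open_face E \<sigma> d (x, y, z) S" using open_faces_remove1[OF faces xyz] by blast
    then have deep: "deep E d (\<sigma> x) (\<sigma> y) (\<sigma> z) S" by (simp add: open_face_def)
    show ?thesis using deep_edges[OF deep] by simp
  qed
  then have edges: "sound_edge \<sigma> (set vs) (x, y) \<and> sound_edge \<sigma> (set vs) (x, z) \<and> sound_edge \<sigma> (set vs) (y, z)"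
    if "(x, y, z) \<in> set ?fs" for x y z
    using fs[OF that] that by (simp add: sound_edge_def)
  have "\<forall>e\<in>set (face_edges ?fs). sound_edge \<sigma> (set vs) e"
    unfolding set_face_edges using edges by blast
  moreover have "\<forall>(x, y, z)\<in>set ?fs. {x, y, z} \<subseteq> set vs" using fs by blast
  ultimately have "realizes \<sigma> d (set vs) (face_edges ?fs) ?fs"
    unfolding realizes_def using mono X faces by blast
  then show False by (rule wins_False[OF wins])
qed

section \<open>Sorted families of pairs and the four forbidden configurations\<close>

definition rungs :: "int \<Rightarrow> int \<Rightarrow> nat \<Rightarrow> (nat \<Rightarrow> int) \<Rightarrow> (nat \<Rightarrow> int) \<Rightarrow> (nat \<Rightarrow> int set) \<Rightarrow> bool" where
  "rungs A B n y z C \<longleftrightarrow>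
     (\<forall>i<n. flanked E 7 A B (y i) (z i) (C i) \<and> A \<notin> C i \<and> B \<notin> C i \<and> y i < z i) \<and>
     (\<forall>i<n. \<forall>j<n. i \<noteq> j \<longrightarrow> C i \<inter> C j = {}) \<and> strict_mono_on {..<n} y \<and> strict_mono_on {..<n} z"

lemma rungs_reindex:
  assumes "rungs A B n y z C" "strict_mono_on {..<m} f" "\<And>i. i < m \<Longrightarrow> f i < n"
  shows "rungs A B m (y \<circ> f) (z \<circ> f) (C \<circ> f)"
proof -
  have "f i \<noteq> f j" if "i < m" "j < m" "i \<noteq> j" for i j
    using strict_mono_on_imp_inj_on[OF assms(2)] that by (auto simp: inj_on_def)
  moreover have "strict_mono_on {..<m} (g \<circ> f)" if "strict_mono_on {..<n} g" for g :: "nat \<Rightarrow> int"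
    using that assms(2,3) by (auto intro!: strict_mono_onI elim!: strict_mono_onD)
  ultimately show ?thesis
    using assms(1,3) unfolding rungs_def by simp
qed

text \<open>The initial vertices of a game are 0, 16, 32 and so on; \<open>\<sigma>\<close> sends
  the vertex with index \<open>i\<close> to entry \<open>i\<close> of \<open>L\<close>, the list of
  actual vertices from left to right. For concrete games the remaining side conditions are finite
  computations.\<close>

lemma wins_rungs_False:
  fixes L :: "int list"
  defines "\<sigma> \<equiv> \<lambda>x. L ! nat (x div 16)"
  assumes wins: "let fs = pair_faces a b ps in wins 7 (map ((*) 16) [0..k]) (face_edges fs) fs t"
    and rungs: "rungs A B m y z C"
    and L: "sorted_wrt (<) L" "int (length L) = k + 1"
    and verts: "set (map ((*) 16) [0..k]) = {a, b} \<union> fst ` set ps \<union> snd ` set ps"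
    and ord: "\<forall>(y, z)\<in>set ps. y < z \<and> a \<noteq> y \<and> a \<noteq> z \<and> b \<noteq> y \<and> b \<noteq> z"
    and vals: "\<sigma> a = A" "\<sigma> b = B" "map (\<lambda>p. (\<sigma> (fst p), \<sigma> (snd p))) ps = map (\<lambda>i. (y i, z i)) [0..<m]"
  shows False
proof (rule wins_pairs_False[where \<sigma> = \<sigma>])
  have len: "length ps = m" using arg_cong[OF vals(3), of length] by simp
  have nth: "\<sigma> (fst (ps ! i)) = y i" "\<sigma> (snd (ps ! i)) = z i" if "i < m" for i
    using arg_cong[OF vals(3), of "\<lambda>xs. xs ! i"] that len by simp_all
  show "wins 7 (map ((*) 16) [0..k]) (face_edges (pair_faces a b ps)) (pair_faces a b ps) t"
    using wins by (simp add: Let_def)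
  show "strict_mono_on (set (map ((*) 16) [0..k])) \<sigma>"
  proof (rule strict_mono_onI)
    fix u v assume "u \<in> set (map ((*) 16) [0..k])" "v \<in> set (map ((*) 16) [0..k])" "u < v"
    then obtain i j where "u = 16 * i" "v = 16 * j" "0 \<le> i" "i < j" "j \<le> k" by auto
    then show "\<sigma> u < \<sigma> v"
      using sorted_wrt_nth_less[OF L(1), of "nat i" "nat j"] L(2) by (simp add: \<sigma>_def)
  qed
  show "flanked E 7 (\<sigma> a) (\<sigma> b) (\<sigma> (fst (ps ! i))) (\<sigma> (snd (ps ! i))) (C i)"
    "\<sigma> a \<notin> C i \<and> \<sigma> b \<notin> C i" if "i < length ps" for i
    using rungs that nth len vals(1,2) unfolding rungs_def by simp_all
  show "C i \<inter> C j = {}" if "i < length ps" "j < length ps" "i \<noteq> j" for i j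
    using rungs that len unfolding rungs_def by simp
qed (use verts ord in auto)

lemma rungs_mono:
  assumes "rungs A B n y z C" "i < j" "j < n"
  shows "y i < y j" "z i < z j"
  using assms strict_mono_onD[of "{..<n}" y i j] strict_mono_onD[of "{..<n}" z i j]
  unfolding rungs_def by simp_all

lemma rungs_less: "rungs A B n y z C \<Longrightarrow> i < n \<Longrightarrow> y i < z i"
  by (simp add: rungs_def)

lemma rungs_across:
  assumes "rungs A B 7 y z C" "A < B" "y 6 < A" "B < z 0"
  shows False
proof -
  have "sorted_wrt (<) [y 0, y 1, y 2, y 3, y 4, y 5, y 6, A, B, z 0, z 1, z 2, z 3, z 4, z 5, z 6]"
    using assms(2-4)
    rungs_mono[OF assms(1), of 0 1]
    rungs_mono[OF assms(1), of 1 2]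
    rungs_mono[OF assms(1), of 2 3]
    rungs_mono[OF assms(1), of 3 4]
    rungs_mono[OF assms(1), of 4 5]
    rungs_mono[OF assms(1), of 5 6]
    by (simp add: numeral_nat)
  then show False
    by (rule wins_rungs_False[OF wins_across assms(1)])
      (code_simp | simp add: upt_rec)+
qed

lemma rungs_astride:
  assumes "rungs A B 6 y z C" "y 5 < A" "A < z 0" "z 5 < B"
  shows False
proof -
  have "sorted_wrt (<) [y 0, y 1, y 2, y 3, y 4, y 5, A, z 0, z 1, z 2, z 3, z 4, z 5, B]"
    using assms(2-4)
    rungs_mono[OF assms(1), of 0 1]
    rungs_mono[OF assms(1), of 1 2]
    rungs_mono[OF assms(1), of 2 3]
    rungs_mono[OF assms(1), of 3 4]
    rungs_mono[OF assms(1), of 4 5]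
    by (simp add: numeral_nat)
  then show False
    by (rule wins_rungs_False[OF wins_astride assms(1)])
      (code_simp | simp add: upt_rec)+
qed

lemma rungs_twisted:
  assumes "rungs A B 6 y z C" "A < B" "y 5 < z 0" "z 5 < A"
  shows False
proof -
  have "sorted_wrt (<) [y 0, y 1, y 2, y 3, y 4, y 5, z 0, z 1, z 2, z 3, z 4, z 5, A, B]"
    using assms(2-4)
    rungs_mono[OF assms(1), of 0 1]
    rungs_mono[OF assms(1), of 1 2]
    rungs_mono[OF assms(1), of 2 3]
    rungs_mono[OF assms(1), of 3 4]
    rungs_mono[OF assms(1), of 4 5]
    by (simp add: numeral_nat)
  then show False
    by (rule wins_rungs_False[OF wins_twisted assms(1)])
      (code_simp | simp add: upt_rec)+
qed

lemma rungs_separated: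
  assumes "rungs A B 5 y z C" "A < B" "z 0 < y 1" "z 1 < y 2" "z 2 < y 3" "z 3 < y 4" "z 4 < A"
  shows False
proof -
  have "sorted_wrt (<) [y 0, z 0, y 1, z 1, y 2, z 2, y 3, z 3, y 4, z 4, A, B]"
    using assms(2-7) rungs_less[OF assms(1), of 0] rungs_less[OF assms(1), of 1]
    rungs_less[OF assms(1), of 2] rungs_less[OF assms(1), of 3] rungs_less[OF assms(1), of 4]
    by simp
  then show False
    by (rule wins_rungs_False[OF wins_separated assms(1)])
      (code_simp | simp add: upt_rec)+
qed

text \<open>Sorting one queue class by left ends sorts the right ends as well, since an inversion
  would nest two edges of the same queue.\<close>

lemma sorted_rungs:
  fixes y z :: "'k \<Rightarrow> int"
  assumes "finite K" "n \<le> card K"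
    and K: "\<And>k. k \<in> K \<Longrightarrow> flanked E 7 A B (y k) (z k) (C k) \<and> A \<notin> C k \<and> B \<notin> C k \<and>
      y k < z k \<and> q {y k, z k} = c"
    and disj: "\<And>k l. k \<in> K \<Longrightarrow> l \<in> K \<Longrightarrow> k \<noteq> l \<Longrightarrow> C k \<inter> C l = {}"
  obtains f where "\<And>i. i < n \<Longrightarrow> f i \<in> K" "rungs A B n (y \<circ> f) (z \<circ> f) (C \<circ> f)"
proof -
  have mem: "y k \<in> C k" "z k \<in> C k" if "k \<in> K" for k
    using K[OF that] unfolding flanked_def by simp_all
  have inj: "inj_on y K"
  proof (rule inj_onI, rule ccontr)
    fix k l assume kl: "k \<in> K" "l \<in> K" "y k = y l" "k \<noteq> l"
    then show False using disj[OF kl(1,2,4)] mem(1)[OF kl(1)] mem(1)[OF kl(2)] by auto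
  qed
  define ys where "ys = sorted_list_of_set (y ` K)"
  have ys: "sorted_wrt (<) ys" "set ys = y ` K" "length ys = card K"
    using assms(1) card_image[OF inj] by (simp_all add: ys_def)
  define f where "f i = inv_into K y (ys ! i)" for i
  have nth: "ys ! i \<in> y ` K" if "i < n" for i using that assms(2) ys nth_mem[of i ys] by simp
  have f: "f i \<in> K" "y (f i) = ys ! i" if "i < n" for i
    using inv_into_into[OF nth[OF that]] f_inv_into_f[OF nth[OF that]] by (simp_all add: f_def)
  have y_mono: "y (f i) < y (f j)" if "i < j" "j < n" for i j
    using sorted_wrt_nth_less[OF ys(1) that(1)] f(2) that assms(2) ys(3) by simp
  have z_mono: "z (f i) < z (f j)" if ij: "i < j" "j < n" for i j
  proof (rule ccontr)
    assume "\<not> z (f i) < z (f j)"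
    have K': "f i \<in> K" "f j \<in> K" using f(1) ij by simp_all
    have "f i \<noteq> f j" using y_mono[OF ij] by auto
    \<comment> \<open>Equal right ends would be a common element of two disjoint
      territories.\<close>
    then have "z (f i) \<noteq> z (f j)"
      using disj[OF K'] mem(2)[OF K'(1)] mem(2)[OF K'(2)] by auto
    then have lt: "z (f j) < z (f i)" using \<open>\<not> z (f i) < z (f j)\<close> by simp
    have edge: "{y k, z k} \<in> E" if k: "k \<in> K" for k
    proof -
      obtain S where "deep E 7 (y k) (z k) A S" using K[OF k] unfolding flanked_def by blast
      then show ?thesis by (rule deep_edges)
    qed
    show False
      using q_nested[OF edge[OF K'(1)] edge[OF K'(2)] y_mono[OF ij] _ lt] K[OF K'(1)] K[OF K'(2)] by simp
  qed
  have "strict_mono_on {..<n} (y \<circ> f)" "strict_mono_on {..<n} (z \<circ> f)"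
    using y_mono z_mono by (auto intro!: strict_mono_onI)
  moreover have "(C \<circ> f) i \<inter> (C \<circ> f) j = {}" if "i < n" "j < n" "i \<noteq> j" for i j
  proof -
    have "f i \<noteq> f j" using y_mono[of i j] y_mono[of j i] that by (cases "i < j") auto
    then show ?thesis using disj f(1) that by simp
  qed
  ultimately have "rungs A B n (y \<circ> f) (z \<circ> f) (C \<circ> f)"
    using f(1) K unfolding rungs_def by simp
  then show thesis using that f(1) by blast
qed

text \<open>If \<open>y (i + 5) < z i\<close> for some \<open>i\<close>, the six consecutive pairs
  from \<open>i\<close> on cross pairwise. Otherwise every fifth pair is separated from the next,
  and indices 0, 5, 10, 15, 20 give five separated pairs; this is why 21 pairs are taken.\<close>

lemma rungs_left:
  assumes rungs: "rungs A B 21 y z C" and left: "\<And>i. i < 21 \<Longrightarrow> z i < A" and "A < B"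
  shows False
proof (cases "\<exists>i\<le>15. y (i + 5) < z i")
  case True
  then obtain i where i: "i \<le> 15" "y (i + 5) < z i" by blast
  let ?f = "\<lambda>j. i + j"
  have "rungs A B 6 (y \<circ> ?f) (z \<circ> ?f) (C \<circ> ?f)"
    using rungs by (rule rungs_reindex) (use i(1) in \<open>auto intro: strict_mono_onI\<close>)
  then show False by (rule rungs_twisted) (use i left[of "i + 5"] \<open>A < B\<close> in simp_all)
next
  case False
  have sep: "z i < y (i + 5)" if "i \<le> 15" for i
  proof -
    have "z i \<in> C i" "y (i + 5) \<in> C (i + 5)" "C i \<inter> C (i + 5) = {}"
      using rungs that unfolding rungs_def flanked_def by simp_all
    then have "y (i + 5) \<noteq> z i" by auto
    moreover have "\<not> y (i + 5) < z i" using False that by blast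
    ultimately show ?thesis by simp
  qed
  let ?f = "\<lambda>j. 5 * j"
  have "rungs A B 5 (y \<circ> ?f) (z \<circ> ?f) (C \<circ> ?f)"
    using rungs by (rule rungs_reindex) (auto intro: strict_mono_onI)
  then show False
    by (rule rungs_separated)
      (use sep[of 0] sep[of 5] sep[of 10] sep[of 15] left[of 20] \<open>A < B\<close> in simp_all)
qed

lemma left_class_False:
  fixes y z :: "'k \<Rightarrow> int"
  assumes "finite K" "21 \<le> card K" "A < B"
    and K: "\<And>k. k \<in> K \<Longrightarrow> flanked E 7 A B (y k) (z k) (C k) \<and> A \<notin> C k \<and> B \<notin> C k \<and>
      y k < z k \<and> q {y k, z k} = c"
    and disj: "\<And>k l. k \<in> K \<Longrightarrow> l \<in> K \<Longrightarrow> k \<noteq> l \<Longrightarrow> C k \<inter> C l = {}"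
    and cases: "(\<forall>k\<in>K. z k < A) \<or> (\<forall>k\<in>K. y k < A \<and> A < z k \<and> z k < B) \<or> (\<forall>k\<in>K. y k < A \<and> B < z k)"
  shows False
proof -
  obtain f where f: "\<And>i. i < 21 \<Longrightarrow> f i \<in> K" and rungs: "rungs A B 21 (y \<circ> f) (z \<circ> f) (C \<circ> f)"
    using sorted_rungs[where y = y and z = z and C = C, OF assms(1,2) K disj] by blast
  \<comment> \<open>The games for the other two types use only the first six or seven pairs.\<close>
  have sub: "rungs A B m (y \<circ> f) (z \<circ> f) (C \<circ> f)" if "m \<le> 21" for m
    using rungs_reindex[OF rungs, of m id] that by (simp add: strict_mono_on_def)
  from cases show False
  proof (elim disjE)
    assume "\<forall>k\<in>K. z k < A"
    then show False using rungs_left[OF rungs _ \<open>A < B\<close>] f by simp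
  next
    assume "\<forall>k\<in>K. y k < A \<and> A < z k \<and> z k < B"
    then show False using rungs_astride[OF sub[of 6]] f[of 0] f[of 5] by simp
  next
    assume "\<forall>k\<in>K. y k < A \<and> B < z k"
    then show False using rungs_across[OF sub[of 7] \<open>A < B\<close>] f[of 0] f[of 6] by simp
  qed
qed

text \<open>In the reversed order, with \<open>- B\<close> and \<open>- A\<close> as the base edge,
  these two types become both ends left of the base edge and one end on each side of its left
  endpoint.\<close>

lemma right_class_False:
  fixes y z :: "'k \<Rightarrow> int"
  assumes "finite K" "21 \<le> card K" "A < B"
    and K: "\<And>k. k \<in> K \<Longrightarrow> flanked E 7 A B (y k) (z k) (C k) \<and> A \<notin> C k \<and> B \<notin> C k \<and>
      y k < z k \<and> q {y k, z k} = c"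
    and disj: "\<And>k l. k \<in> K \<Longrightarrow> l \<in> K \<Longrightarrow> k \<noteq> l \<Longrightarrow> C k \<inter> C l = {}"
    and cases: "(\<forall>k\<in>K. B < y k) \<or> (\<forall>k\<in>K. A < y k \<and> y k < B \<and> B < z k)"
  shows False
proof -
  interpret mirror: three_queue "(`) uminus ` E" "q \<circ> (`) uminus"
    by (rule three_queue_uminus) (rule three_queue_axioms)
  show False
  proof (rule mirror.left_class_False[where K = K and A = "- B" and B = "- A"
        and y = "\<lambda>k. - z k" and z = "\<lambda>k. - y k" and C = "\<lambda>k. uminus ` C k" and c = c])
    fix k assume "k \<in> K"
    from K[OF this] show "flanked ((`) uminus ` E) 7 (- B) (- A) (- z k) (- y k) (uminus ` C k) \<and>
        - B \<notin> uminus ` C k \<and> - A \<notin> uminus ` C k \<and> - z k < - y k \<and>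
        (q \<circ> (`) uminus) {- z k, - y k} = c"
      using flanked_uminus by (auto simp: insert_commute)
  next
    fix k l assume "k \<in> K" "l \<in> K" "k \<noteq> l"
    from disj[OF this] show "uminus ` C k \<inter> uminus ` C l = {}" by auto
  qed (use assms(1-3) cases in auto)
qed

section \<open>Finding an edge nested in the base edge\<close>

text \<open>If none of 301 disjoint pairs lies inside the base edge, five types and three queues
  make 15 classes; as 301 = 15 * 20 + 1, some class has 21 pairs and is refuted. Each pair costs two
  levels, hence 602. The face \<open>y z A\<close> retains depth \<open>d\<close>, so the argument
  can be repeated with base edge \<open>y z\<close>.\<close>

lemma inner_pair:
  assumes deep: "deep E (d + 602) A B c S" and "7 \<le> d" "A < B" "A \<notin> S" "B \<notin> S"
  obtains y z T where "A < y" "y < z" "z < B" "deep E d y z A T" "y \<notin> T" "z \<notin> T"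
proof -
  have "deep E (d + 2 * 301) A B c S" using deep by simp
  from deep_pairs[OF this] obtain y z C where
    pairs: "\<forall>i<301::nat. flanked E d A B (y i) (z i) (C i) \<and> C i \<subseteq> S"
    and disj: "\<forall>i<301::nat. \<forall>j<301. i \<noteq> j \<longrightarrow> C i \<inter> C j = {}" by (elim exE conjE)
  define l r where "l i = min (y i) (z i)" and "r i = max (y i) (z i)" for i
  have flank: "flanked E d A B (l i) (r i) (C i)" if "i < 301" for i :: nat
    using pairs that flanked_swap[of E d A B "y i" "z i" "C i"] by (auto simp: l_def r_def min_def max_def)
  have lr: "l i < r i" "l i \<in> C i" "r i \<in> C i" if "i < 301" for i
    using flank[OF that] unfolding flanked_def l_def r_def by auto
  have AB: "A \<notin> C i" "B \<notin> C i" if "i < 301" for i using pairs that assms(4,5) by auto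
  show thesis
  proof (cases "\<exists>i<301. A < l i \<and> r i < B")
    case True
    then obtain i where i: "i < 301" "A < l i" "r i < B" by blast
    obtain T where "T \<subseteq> C i - {l i, r i}" "deep E d (l i) (r i) A T"
      using flank[OF i(1)] unfolding flanked_def by blast
    then show ?thesis using that[of "l i" "r i" T] i lr(1)[OF i(1)] by blast
  next
    case False
    define kind :: "nat \<Rightarrow> nat" where "kind i = (if r i < A then 0 else if l i < A \<and> r i < B then 1
      else if l i < A then 2 else if B < l i then 3 else 4)" for i
    define kq where "kq i = (kind i, q {l i, r i})" for i
    have edge: "{l i, r i} \<in> E" if i: "i < 301" for i
    proof -
      obtain T where "deep E d (l i) (r i) A T" using flank[OF i] unfolding flanked_def by blast
      then show ?thesis by (rule deep_edges)
    qed
    have "kq \<in> {..<301} \<rightarrow> {..<5} \<times> {..<3}"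
      using q_less[OF edge] by (auto simp: kq_def kind_def)
    from pigeonhole_card[OF this] obtain k c where "k < 5"
      and "301 \<le> card (kq -` {(k, c)} \<inter> {..<301}) * 15"
      by (auto simp: lessThan_empty_iff)
    then have card: "21 \<le> card (kq -` {(k, c)} \<inter> {..<301})" by linarith
    define K where "K = kq -` {(k, c)} \<inter> {..<301}"
    have K: "i < 301" "kind i = k" "q {l i, r i} = c" if "i \<in> K" for i
      using that by (auto simp: K_def kq_def)
    have fin: "finite K" "21 \<le> card K" using card by (simp_all add: K_def)
    have all: "flanked E 7 A B (l i) (r i) (C i) \<and> A \<notin> C i \<and> B \<notin> C i \<and> l i < r i \<and> q {l i, r i} = c"
      if "i \<in> K" for i
      using flanked_le[OF flank \<open>7 \<le> d\<close>] AB lr(1) K[OF that] by simp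
    have dis: "C i \<inter> C j = {}" if "i \<in> K" "j \<in> K" "i \<noteq> j" for i j
      using disj K(1) that by simp
    \<comment> \<open>The ends lie in \<open>C i\<close>, whereas \<open>A\<close> and
      \<open>B\<close> do not; the exclusion of inner pairs is the assumption of this case. With
      these facts the nested conditionals of \<open>kind\<close> become the exact types listed in
      \<open>kinds\<close>.\<close>
    have pos: "l i \<noteq> A" "l i \<noteq> B" "r i \<noteq> A" "r i \<noteq> B" "\<not> (A < l i \<and> r i < B)" "l i < r i" if "i \<in> K" for i
      using lr[OF K(1)[OF that]] AB[OF K(1)[OF that]] False K(1)[OF that] by auto
    have kinds: "(k = 0 \<longrightarrow> r i < A) \<and> (k = 1 \<longrightarrow> l i < A \<and> A < r i \<and> r i < B) \<and>
      (k = 2 \<longrightarrow> l i < A \<and> B < r i) \<and> (k = 3 \<longrightarrow> B < l i) \<and>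
      (k = 4 \<longrightarrow> A < l i \<and> l i < B \<and> B < r i)" if "i \<in> K" for i
      using K(2)[OF that] pos[OF that] unfolding kind_def
      by (smt (verit) numeral_eq_iff zero_neq_numeral one_eq_numeral_iff zero_neq_one semiring_norm)
    from \<open>k < 5\<close> consider "k = 0" | "k = 1" | "k = 2" | "k = 3" | "k = 4" by linarith
    then have False
    proof cases
      case 1
      then have "\<forall>i\<in>K. r i < A" using kinds by simp
      then show False using left_class_False[where y = l and z = r and C = C, OF fin \<open>A < B\<close> all dis] by blast
    next
      case 2
      then have "\<forall>i\<in>K. l i < A \<and> A < r i \<and> r i < B"
        using kinds by simp
      then show False using left_class_False[where y = l and z = r and C = C, OF fin \<open>A < B\<close> all dis] by blast
    next
      case 3
      then have "\<forall>i\<in>K. l i < A \<and> B < r i"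
        using kinds by simp
      then show False using left_class_False[where y = l and z = r and C = C, OF fin \<open>A < B\<close> all dis] by blast
    next
      case 4
      then have "\<forall>i\<in>K. B < l i" using kinds by simp
      then show False using right_class_False[where y = l and z = r and C = C, OF fin \<open>A < B\<close> all dis] by blast
    next
      case 5
      then have "\<forall>i\<in>K. A < l i \<and> l i < B \<and> B < r i"
        using kinds by simp
      then show False using right_class_False[where y = l and z = r and C = C, OF fin \<open>A < B\<close> all dis] by blast
    qed
    then show ?thesis ..
  qed
qed

text \<open>Three rounds at 602 levels each, with the depth 7 required by the games left at the end:
  1813 = 3 * 602 + 7. The three edges obtained and the base edge form a rainbow.\<close>

lemma no_deep_face:
  assumes "deep E 1813 A B c S" "A < B" "A \<notin> S" "B \<notin> S"
  shows False
proof -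
  have "deep E (1211 + 602) A B c S" using assms(1) by simp
  from inner_pair[OF this _ assms(2-4)] obtain y1 z1 T1 where 1: "A < y1" "y1 < z1" "z1 < B"
    "deep E 1211 y1 z1 A T1" "y1 \<notin> T1" "z1 \<notin> T1" by auto
  have "deep E (609 + 602) y1 z1 A T1" using 1(4) by simp
  from inner_pair[OF this _ 1(2,5,6)] obtain y2 z2 T2 where 2: "y1 < y2" "y2 < z2" "z2 < z1"
    "deep E 609 y2 z2 y1 T2" "y2 \<notin> T2" "z2 \<notin> T2" by auto
  have "deep E (7 + 602) y2 z2 y1 T2" using 2(4) by simp
  from inner_pair[OF this _ 2(2,5,6)] obtain y3 z3 T3 where 3: "y2 < y3" "y3 < z3" "z3 < z2"
    "deep E 7 y3 z3 y2 T3" "y3 \<notin> T3" "z3 \<notin> T3" by auto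
  show False
    by (rule no_rainbow[OF deep_edges(1)[OF assms(1)] deep_edges(1)[OF 1(4)] deep_edges(1)[OF 2(4)]
      deep_edges(1)[OF 3(4)] 1(1) 2(1) 3(1,2,3) 2(3) 1(3)])
qed

end

section \<open>Transfer to queue layouts of graphs\<close>

lemma deep_face_not_queue_layout:
  assumes deep: "deep E 1813 a b c S" and "a \<in> V" "b \<in> V" "S \<subseteq> V" "a \<noteq> b" "a \<notin> S" "b \<notin> S"
    and sub: "\<And>e. e \<in> E \<Longrightarrow> e \<subseteq> V" and layout: "queue_layout V E k vs q" and "k \<le> 3"
  shows False
proof -
  have vs: "distinct vs" "set vs = V" "\<forall>e\<in>E. q e < k"
    and nest: "\<And>s1 t1 s2 t2. \<lbrakk>{s1, t1} \<in> E; {s2, t2} \<in> E; q {s1, t1} = q {s2, t2};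
      prec vs s1 s2; prec vs s2 t2; prec vs t2 t1\<rbrakk> \<Longrightarrow> False"
    using layout unfolding queue_layout_def by blast+
  define pos where "pos x = int (SOME i. i < length vs \<and> vs ! i = x)" for x
  have pos: "nat (pos x) < length vs" "vs ! nat (pos x) = x" "0 \<le> pos x" if "x \<in> V" for x
  proof -
    have "\<exists>i. i < length vs \<and> vs ! i = x" using that vs(2) by (metis in_set_conv_nth)
    from someI_ex[OF this] show "nat (pos x) < length vs" "vs ! nat (pos x) = x" "0 \<le> pos x"
      by (simp_all add: pos_def)
  qed
  have inj: "inj_on pos V" using pos(2) by (metis inj_onI)
  have prec: "prec vs x y" if "x \<in> V" "y \<in> V" "pos x < pos y" for x y
    unfolding prec_def using pos[OF that(1)] pos[OF that(2)] that(3)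
    by (intro exI[of _ "nat (pos x)"] exI[of _ "nat (pos y)"]) auto
  define E' where "E' = (`) pos ` E"
  \<comment> \<open>Edges between positions are translated back through the list \<open>vs\<close>,
    which inverts \<open>pos\<close> on \<open>V\<close>.\<close>
  define q' where "q' e = q ((\<lambda>i. vs ! nat i) ` e)" for e
  have q': "q' (pos ` e) = q e" if "e \<in> E" for e
  proof -
    have "(\<lambda>x. vs ! nat (pos x)) ` e = e" using pos(2) sub[OF that] by force
    then show ?thesis by (simp add: q'_def image_image)
  qed
  have E': "\<exists>x y. {x, y} \<in> E \<and> x \<in> V \<and> y \<in> V \<and> s = pos x \<and> t = pos y" if st: "{s, t} \<in> E'" for s t
  proof -
    obtain e where e: "e \<in> E" "{s, t} = pos ` e" using st unfolding E'_def by blast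
    obtain x y where xy: "x \<in> e" "y \<in> e" "s = pos x" "t = pos y" using e(2) by blast
    \<comment> \<open>A priori \<open>e\<close> is just some set with image \<open>{s, t}\<close>;
      injectivity of \<open>pos\<close> on \<open>V\<close> shows that it has no further
      elements.\<close>
    have "e \<subseteq> {x, y}"
    proof
      fix u assume "u \<in> e"
      then have "pos u = pos x \<or> pos u = pos y" using e(2) xy(3,4) by blast
      then show "u \<in> {x, y}" using inj \<open>u \<in> e\<close> xy(1,2) sub[OF e(1)] by (auto dest: inj_onD)
    qed
    then have "e = {x, y}" using xy(1,2) by blast
    then show ?thesis using e(1) xy sub[OF e(1)] by blast
  qed
  interpret three_queue E' q'
  proof
    fix e assume "e \<in> E'"
    then show "q' e < 3" using q' vs(3) \<open>k \<le> 3\<close> unfolding E'_def by fastforce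
  next
    fix s1 t1 s2 t2 :: int
    assume st: "{s1, t1} \<in> E'" "{s2, t2} \<in> E'" "s1 < s2" "s2 < t2" "t2 < t1"
    obtain x1 y1 where 1: "{x1, y1} \<in> E" "x1 \<in> V" "y1 \<in> V" "s1 = pos x1" "t1 = pos y1"
      using E'[OF st(1)] by blast
    obtain x2 y2 where 2: "{x2, y2} \<in> E" "x2 \<in> V" "y2 \<in> V" "s2 = pos x2" "t2 = pos y2"
      using E'[OF st(2)] by blast
    have "q {x1, y1} \<noteq> q {x2, y2}"
      using nest[OF 1(1) 2(1)] prec st(3-5) 1(2-5) 2(2-5) by blast
    then show "q' {s1, t1} \<noteq> q' {s2, t2}" using q'[OF 1(1)] q'[OF 2(1)] 1(4,5) 2(4,5) by simp
  qed
  have image: "deep E' 1813 (pos a) (pos b) (pos c) (pos ` S)"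
    using deep
  proof (rule deep_image)
    show "inj_on pos S" using inj \<open>S \<subseteq> V\<close> by (rule inj_on_subset)
    show "{pos x, pos y} \<in> E'" if "{x, y} \<in> E" for x y
      using imageI[OF that, of "(`) pos"] by (simp add: E'_def)
  qed
  have notin: "pos a \<notin> pos ` S" "pos b \<notin> pos ` S"
    using inj assms(2-4,6,7) by (auto dest: inj_onD)
  have "pos a \<noteq> pos b" using inj assms(2,3,5) by (auto dest: inj_onD)
  \<comment> \<open>The base edge must be oriented from left to right; in the second case the
    corners are exchanged.\<close>
  then consider "pos a < pos b" | "pos b < pos a" by linarith
  then show False
  proof cases
    case 1
    then show False using no_deep_face[OF image] notin by simp
  next
    case 2
    then show False using no_deep_face[OF deep_swap12[OF image]] notin by simp
  qed
qed

theorem mainTheorem2: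
  shows "\<exists>(V :: nat set) E. planar_3_tree V E \<and> queue_number V E \<ge> 4"
proof -
  obtain V S :: "nat set" and E where V: "planar_3_tree V E" "S \<subseteq> V - {0, 1, 2}" "{0, 1, 2} \<subseteq> V"
    "deep E 1813 0 1 2 S"
    using planar_3_tree_deep[of 1813] by blast
  obtain Fs where p3t: "p3t V E Fs" using V(1) unfolding planar_3_tree_def by blast
  have "\<exists>vs q. queue_layout V E (queue_number V E) vs q"
    unfolding queue_number_def
    using queue_layout_exists[OF p3t_finite[OF p3t] p3t_edge_subset[OF p3t]] by (rule LeastI_ex)
  then obtain vs q where "queue_layout V E (queue_number V E) vs q" by blast
  then have "\<not> queue_number V E \<le> 3"
    using deep_face_not_queue_layout[OF V(4) _ _ _ _ _ _ p3t_edge_subset[OF p3t]] V(2,3) by auto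
  then have "4 \<le> queue_number V E" by simp
  then show ?thesis using V(1) by blast
qed

end
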